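(* For the Dynkin diagram of type $C_n$ and a finite field $\mathbb{F}_q$ of characteristic greater than $2$, $$\#\mathcal{M}_{C_n}(\mathbb{F}_q)=(q-n-1)(q-3)(q-5)\cdots(q-2n+1),$$ and the number of connected components of $\mathcal{M}_{C_n}(\mathbb{R})$ is $$|\pi_0(\mathcal{M}_{C_n}(\mathbb{R}))|=\tfrac12\big(2^n(n+1)!+2^nn!\big)=2^{n-1}(n+2)\,n!.$$
   Context: Let $P_{2n+2}$ be the convex $(2n+2)$-gon with vertices cyclically labeled $1,2,\dots,n+1,\bar1,\bar2,\dots,\overline{n+1}$. Let $\Pi$ be the set consisting of the long diagonals $[i,\bar i]=(i,\bar i)$ for $1\le i\le n+1$, and the pairs of centrally symmetric (non-long) diagonals $[i,j]=\{(i,j),(\bar i,\bar j)\}$ for $1\le i<j-1<n+1$ and $[i,\bar j]=\{(i,\bar j),(j,\bar i)\}$ for $1\le i<j\le n+1$, $(i,j)\ne(1,n+1)$ (sides of the polygon excluded; $|\Pi|=n^2+n$). $\Pi$ indexes the mutable cluster variables of a cluster algebra of type $C_n$. The type $C_n$ compatibility degree $(\gamma\|\omega)$ is the number of crossings (in the interior of the polygon) of one of the diagonals representing $\omega$ with the diagonals representing $\gamma$; for example $([1,\bar1]\|[2,\bar3])=1$ and $([2,\bar3]\|[1,\bar1])=2$. The cluster configuration space $\mathcal{M}_{C_n}$ is considered as a scheme over $\mathbb{Z}$: for a field $k$, $\mathcal{M}_{C_n}(k)$ is the set of $(u_\gamma)_{\gamma\in\Pi}\in(k^\times)^\Pi$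 satisfying $u_\gamma+\prod_{\omega\in\Pi}u_\omega^{(\omega\|\gamma)}=1$ for all $\gamma\in\Pi$. The product $(q-3)(q-5)\cdots(q-2n+1)$ is over $q-(2k-1)$, $2\le k\le n$. *)

theory Defs
  imports "HOL-Analysis.Analysis"
begin

text \<open>
  The vertices \<open>1, \<dots>, n + 1\<close> of the \<open>(2n + 2)\<close>-gon are represented by themselves, and the vertex
  \<open>i\<close> with a bar by \<open>i + (n + 1)\<close>, so that the cyclic order of the vertices is that of
  \<open>1, \<dots>, 2n + 2\<close>. A diagonal is the set of its two end points, and an element of \<open>\<Pi>\<close> is the set
  of the (one or two) diagonals representing it.
\<close>

definition bar :: "nat \<Rightarrow> nat \<Rightarrow> nat"
  where "bar n i = i + (n + 1)"

definition long_diag :: "nat \<Rightarrow> nat \<Rightarrow> nat set set"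
  where "long_diag n i = {{i, bar n i}}"

definition plain_diag :: "nat \<Rightarrow> nat \<Rightarrow> nat \<Rightarrow> nat set set"
  where "plain_diag n i j = {{i, j}, {bar n i, bar n j}}"

definition mixed_diag :: "nat \<Rightarrow> nat \<Rightarrow> nat \<Rightarrow> nat set set"
  where "mixed_diag n i j = {{i, bar n j}, {j, bar n i}}"

definition diag_classes :: "nat \<Rightarrow> nat set set set"
  where "diag_classes n =
      {long_diag n i | i. 1 \<le> i \<and> i \<le> n + 1} \<union>
      {plain_diag n i j | i j. 1 \<le> i \<and> i < j - 1 \<and> j - 1 < n + 1} \<union>
      {mixed_diag n i j | i j. 1 \<le> i \<and> i < j \<and> j \<le> n + 1 \<and> (i, j) \<noteq> (1, n + 1)}"

text \<open>
  Two diagonals of a convex polygon cross in its interior iff their end points are four distinct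
  vertices that alternate along the boundary.
\<close>

definition crosses :: "nat set \<Rightarrow> nat set \<Rightarrow> bool"
  where "crosses d e \<longleftrightarrow> (\<exists>v\<^sub>1 v\<^sub>2 v\<^sub>3 v\<^sub>4. v\<^sub>1 < v\<^sub>2 \<and> v\<^sub>2 < v\<^sub>3 \<and> v\<^sub>3 < v\<^sub>4 \<and>
      (d = {v\<^sub>1, v\<^sub>3} \<and> e = {v\<^sub>2, v\<^sub>4} \<or> d = {v\<^sub>2, v\<^sub>4} \<and> e = {v\<^sub>1, v\<^sub>3}))"

text \<open>
  The compatibility degree \<open>(\<gamma>\<parallel>\<omega>)\<close>. It is not symmetric: one diagonal \<open>e\<close> is picked from the
  second argument. By \<open>compat_degree_eq\<close> below the choice is irrelevant.
\<close>

definition compat_degree :: "nat set set \<Rightarrow> nat set set \<Rightarrow> nat"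
  where "compat_degree \<gamma> \<omega> = (let e = (SOME e. e \<in> \<omega>) in card {d \<in> \<gamma>. crosses d e})"

definition config_space :: "nat \<Rightarrow> (nat set set \<Rightarrow> 'a::field) set"
  where "config_space n = {u \<in> diag_classes n \<rightarrow>\<^sub>E UNIV - {0}.
      \<forall>\<gamma>\<in>diag_classes n. u \<gamma> + (\<Prod>\<omega>\<in>diag_classes n. u \<omega> ^ compat_degree \<omega> \<gamma>) = 1}"

definition config_space_real :: "nat \<Rightarrow> (nat set set \<Rightarrow> real) topology"
  where "config_space_real n =
      subtopology (product_topology (\<lambda>_. euclideanreal) (diag_classes n)) (config_space n)"

lemma finite_diag_classes: "finite (diag_classes n)"
proof -
  have "diag_classes n \<subseteq> long_diag n ` {..n+1} \<union>
      (\<lambda>(i, j). plain_diag n i j) ` ({..n+1} \<times> {..n+1}) \<union>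
      (\<lambda>(i, j). mixed_diag n i j) ` ({..n+1} \<times> {..n+1})"
    unfolding diag_classes_def by (fastforce simp: image_iff)
  then show ?thesis by (rule finite_subset) auto
qed

lemma crosses_pair:
  assumes "a < b" "c < d"
  shows "crosses {a, b} {c, d} \<longleftrightarrow> a < c \<and> c < b \<and> b < d \<or> c < a \<and> a < d \<and> d < b"
proof -
  have pair: "{a, b} = {x, y} \<longleftrightarrow> a = x \<and> b = y" if "a < b" "x < y" for a b x y :: nat
    using that by (auto simp: doubleton_eq_iff)
  have "crosses {a, b} {c, d} \<longleftrightarrow> (\<exists>v1 v2 v3 v4. v1 < v2 \<and> v2 < v3 \<and> v3 < v4 \<and>
      (a = v1 \<and> b = v3 \<and> c = v2 \<and> d = v4 \<or> a = v2 \<and> b = v4 \<and> c = v1 \<and> d = v3))"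
    unfolding crosses_def using assms by (smt (verit) pair less_trans)
  then show ?thesis by auto
qed

lemma diag_classes_cases:
  assumes "\<gamma> \<in> diag_classes n"
  obtains (long) i where "\<gamma> = {{i, bar n i}}" "1 \<le> i" "i \<le> n + 1"
  | (pair) i j where "\<gamma> = {{i, j}, {bar n i, bar n j}}" "1 \<le> i" "i < j" "j \<le> n + 1"
  | (mix) i j where "\<gamma> = {{i, bar n j}, {j, bar n i}}" "1 \<le> i" "i < j" "j \<le> n + 1"
  using assms unfolding diag_classes_def long_diag_def plain_diag_def mixed_diag_def
  by (elim UnE CollectE exE conjE) auto

lemma card_Collect_pair:
  "x \<noteq> y \<Longrightarrow> card {d \<in> {x, y}. P d} = of_bool (P x) + of_bool (P y)"
  by (cases "P x"; cases "P y") (auto simp: card_insert_if Collect_disj_eq conj_disj_distribR Collect_conv_if)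

lemma card_Collect_single: "card {d \<in> {x}. P d} = of_bool (P x)"
  by (cases "P x") (auto simp: Collect_conv_if)

lemma card_crossings_indep:
  assumes "\<gamma> \<in> diag_classes n" "\<omega> \<in> diag_classes n" "e \<in> \<omega>" "e' \<in> \<omega>"
  shows "card {d \<in> \<gamma>. crosses d e} = card {d \<in> \<gamma>. crosses d e'}"
  using assms(2)
proof (cases rule: diag_classes_cases)
  case (long i)
  then show ?thesis using assms(3,4) by simp
next
  case (pair k l)
  have "card {d \<in> \<gamma>. crosses d {k, l}} = card {d \<in> \<gamma>. crosses d {bar n k, bar n l}}"
    using assms(1)
  proof (cases rule: diag_classes_cases)
    case (long i)
    then show ?thesis unfolding long(1) card_Collect_single
      using pair by (auto simp: bar_def crosses_pair)
  next
    case (pair i j)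
    have ne: "{i, j} \<noteq> {bar n i, bar n j}" using pair by (auto simp: bar_def doubleton_eq_iff)
    show ?thesis unfolding pair(1) card_Collect_pair[OF ne]
      using pair(2-) \<open>1 \<le> k\<close> \<open>k < l\<close> \<open>l \<le> n + 1\<close>
      by (auto simp: bar_def crosses_pair)
  next
    case (mix i j)
    have ne: "{i, bar n j} \<noteq> {j, bar n i}" using mix by (auto simp: bar_def doubleton_eq_iff)
    show ?thesis unfolding mix(1) card_Collect_pair[OF ne]
      using mix(2-) \<open>1 \<le> k\<close> \<open>k < l\<close> \<open>l \<le> n + 1\<close>
      by (auto simp: bar_def crosses_pair)
  qed
  then show ?thesis using assms(3,4) pair by auto
next
  case (mix k l)
  have "card {d \<in> \<gamma>. crosses d {k, bar n l}} = card {d \<in> \<gamma>. crosses d {l, bar n k}}"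
    using assms(1)
  proof (cases rule: diag_classes_cases)
    case (long i)
    then show ?thesis unfolding long(1) card_Collect_single
      using mix by (auto simp: bar_def crosses_pair)
  next
    case (pair i j)
    have ne: "{i, j} \<noteq> {bar n i, bar n j}" using pair by (auto simp: bar_def doubleton_eq_iff)
    show ?thesis unfolding pair(1) card_Collect_pair[OF ne]
      using pair(2-) \<open>1 \<le> k\<close> \<open>k < l\<close> \<open>l \<le> n + 1\<close>
      by (auto simp: bar_def crosses_pair)
  next
    case (mix i j)
    have ne: "{i, bar n j} \<noteq> {j, bar n i}" using mix by (auto simp: bar_def doubleton_eq_iff)
    show ?thesis unfolding mix(1) card_Collect_pair[OF ne]
      using mix(2-) \<open>1 \<le> k\<close> \<open>k < l\<close> \<open>l \<le> n + 1\<close>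
      by (auto simp: bar_def crosses_pair)
  qed
  then show ?thesis using assms(3,4) mix by auto
qed

lemma compat_degree_eq:
  assumes "\<gamma> \<in> diag_classes n" "\<omega> \<in> diag_classes n" "e \<in> \<omega>"
  shows "compat_degree \<gamma> \<omega> = card {d \<in> \<gamma>. crosses d e}"
  unfolding compat_degree_def Let_def
  using card_crossings_indep[OF assms(1,2) someI[of "\<lambda>e. e \<in> \<omega>", OF assms(3)] assms(3)] .

text \<open>
  The interlacing criterion agrees with the geometric notion, for any \<open>p\<close> placing the vertices
  counterclockwise in strictly convex position.
\<close>

definition orient :: "complex \<Rightarrow> complex \<Rightarrow> complex \<Rightarrow> real"
  where "orient x y z = Im (cnj (y - x) * (z - x))"

lemma crosses_iff_open_segments_meet:
  fixes p :: "nat \<Rightarrow> complex"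
  assumes ccw: "\<And>u v w. u < v \<Longrightarrow> v < w \<Longrightarrow> w \<le> m \<Longrightarrow> 0 < orient (p u) (p v) (p w)"
    and ab: "a < b" "b \<le> m" and cd: "c < d" "d \<le> m"
  shows "crosses {a, b} {c, d} \<longleftrightarrow>
      {a, b} \<noteq> {c, d} \<and> open_segment (p a) (p b) \<inter> open_segment (p c) (p d) \<noteq> {}"
proof -
  have meet: "open_segment (p w) (p y) \<inter> open_segment (p x) (p z) \<noteq> {}"
    if "w < x" "x < y" "y < z" "z \<le> m" for w x y z
  proof -
    define A B C D where "A = orient (p x) (p y) (p z)" and "B = orient (p w) (p y) (p z)"
      and "C = orient (p w) (p x) (p z)" and "D = orient (p w) (p x) (p y)"
    have pos: "A > 0" "B > 0" "C > 0" "D > 0"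
      unfolding A_def B_def C_def D_def using that by (auto intro!: ccw)
    have sum: "A + C = B + D"
      by (simp add: A_def B_def C_def D_def orient_def algebra_simps)
    have comb: "A *\<^sub>R p w + C *\<^sub>R p y = B *\<^sub>R p x + D *\<^sub>R p z"
      by (simp add: A_def B_def C_def D_def orient_def complex_eq_iff algebra_simps)
    have seg: "(1 / (s + t)) *\<^sub>R (s *\<^sub>R u + t *\<^sub>R v) \<in> open_segment u v"
      if "s > 0" "t > 0" "u \<noteq> v" for s t and u v :: complex
    proof -
      have "(1 / (s + t)) *\<^sub>R (s *\<^sub>R u + t *\<^sub>R v) = (1 - t / (s + t)) *\<^sub>R u + (t / (s + t)) *\<^sub>R v"
        using that by (simp add: scaleR_add_right field_simps)
      moreover have "0 < t / (s + t)" "t / (s + t) < 1" using that by auto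
      ultimately show ?thesis using \<open>u \<noteq> v\<close> unfolding in_segment by blast
    qed
    have "p w \<noteq> p y" "p x \<noteq> p z"
      using pos by (auto simp: A_def B_def C_def D_def orient_def)
    then have "(1 / (A + C)) *\<^sub>R (A *\<^sub>R p w + C *\<^sub>R p y) \<in> open_segment (p w) (p y)"
      "(1 / (A + C)) *\<^sub>R (A *\<^sub>R p w + C *\<^sub>R p y) \<in> open_segment (p x) (p z)"
      using seg[of A C "p w" "p y"] seg[of B D "p x" "p z"] pos by (simp_all add: comb sum)
    then show ?thesis by blast
  qed
  have line: "orient (p u) (p v) x = 0" if mem: "x \<in> open_segment (p u) (p v)" for u v x
  proof -
    obtain t where x: "x = (1 - t) *\<^sub>R p u + t *\<^sub>R p v" using mem unfolding in_segment by blast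
    show ?thesis unfolding x by (simp add: orient_def algebra_simps)
  qed
  have side: "orient (p u) (p v) x > 0"
    if mem: "x \<in> open_segment (p w) (p y)" and sgn: "orient (p u) (p v) (p w) \<ge> 0" "orient (p u) (p v) (p y) \<ge> 0"
      "orient (p u) (p v) (p w) > 0 \<or> orient (p u) (p v) (p y) > 0" for u v w x y
  proof -
    obtain t where t: "0 < t" "t < 1" "x = (1 - t) *\<^sub>R p w + t *\<^sub>R p y"
      using mem unfolding in_segment by blast
    have "orient (p u) (p v) x = (1 - t) * orient (p u) (p v) (p w) + t * orient (p u) (p v) (p y)"
      unfolding t(3) by (simp add: orient_def algebra_simps)
    then show ?thesis using sgn t(1,2)
      by (smt (verit) mult_nonneg_nonneg mult_pos_pos)
  qed
  have rot: "orient x y z = orient y z x" for x y z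
    by (simp add: orient_def algebra_simps)
  have degen: "orient x y x = 0" "orient x y y = 0" for x y
    by (simp_all add: orient_def algebra_simps)
  have right: "orient (p u) (p v) (p w) > 0" if "u < v" "v < w \<or> w < u" "v \<le> m" "w \<le> m" for u v w
    using that ccw[of u v w] ccw[of w u v] rot[of "p w" "p u" "p v"] by auto
  have left: "orient (p v) (p u) (p w) > 0" if "u < w" "w < v" "v \<le> m" for u v w
    using that ccw[of u w v] rot[of "p v" "p u" "p w"] by auto
  have disj: "open_segment (p u) (p v) \<inter> open_segment (p w) (p y) = {}"
    if "u < v" "v \<le> m" "w < y" "y \<le> m" "{u, v} \<noteq> {w, y}"
      "(w \<le> u \<or> v \<le> w) \<and> (y \<le> u \<or> v \<le> y) \<or> (u \<le> w \<and> y \<le> v)" for u v w y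
  proof -
    have "\<exists>u' v'. {u', v'} = {u, v} \<and> orient (p u') (p v') (p w) \<ge> 0 \<and> orient (p u') (p v') (p y) \<ge> 0 \<and>
        (orient (p u') (p v') (p w) > 0 \<or> orient (p u') (p v') (p y) > 0)"
      using that(6)
    proof
      assume outside: "(w \<le> u \<or> v \<le> w) \<and> (y \<le> u \<or> v \<le> y)"
      have pos: "orient (p u) (p v) (p z) > 0 \<or> z \<in> {u, v} \<and> orient (p u) (p v) (p z) = 0"
        if "z \<in> {w, y}" for z
        using right[of u v z] outside that \<open>u < v\<close> \<open>v \<le> m\<close> \<open>w < y\<close> \<open>y \<le> m\<close> degen
        by (cases "z \<in> {u, v}") auto
      show ?thesis using pos[of w] pos[of y] that(1,3,5) by (intro exI[of _ u] exI[of _ v]) auto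
    next
      assume inside: "u \<le> w \<and> y \<le> v"
      have pos: "orient (p v) (p u) (p z) > 0 \<or> z \<in> {u, v} \<and> orient (p v) (p u) (p z) = 0"
        if "z \<in> {w, y}" for z
        using left[of u z v] inside that \<open>u < v\<close> \<open>v \<le> m\<close> \<open>w < y\<close> \<open>y \<le> m\<close> degen
        by (cases "z \<in> {u, v}") auto
      show ?thesis using pos[of w] pos[of y] that(1,3,5) by (intro exI[of _ v] exI[of _ u]) auto
    qed
    then obtain u' v' where uv: "{u', v'} = {u, v}"
      and or: "orient (p u') (p v') (p w) \<ge> 0" "orient (p u') (p v') (p y) \<ge> 0"
        "orient (p u') (p v') (p w) > 0 \<or> orient (p u') (p v') (p y) > 0" by blast
    have "open_segment (p u) (p v) = open_segment (p u') (p v')"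
      using uv by (auto simp: doubleton_eq_iff open_segment_commute)
    then show ?thesis using side[OF _ or] line[of _ u' v'] by fastforce
  qed
  show ?thesis
  proof (cases "crosses {a, b} {c, d}")
    case True
    then consider "a < c" "c < b" "b < d" | "c < a" "a < d" "d < b"
      using crosses_pair[OF ab(1) cd(1)] by blast
    then show ?thesis
    proof cases
      case 1
      then show ?thesis using True meet[of a c b d] cd by (auto simp: doubleton_eq_iff)
    next
      case 2
      then show ?thesis using True meet[of c a d b] ab by (auto simp: doubleton_eq_iff)
    qed
  next
    case False
    then have "(c \<le> a \<or> b \<le> c) \<and> (d \<le> a \<or> b \<le> d) \<or> (a \<le> c \<and> d \<le> b)"
      using crosses_pair[OF ab(1) cd(1)] ab cd by linarith
    then show ?thesis using disj[of a b c d] False ab cd by blast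
  qed
qed

lemma compat_degree_examples:
  assumes "n \<ge> 2"
  shows "compat_degree (long_diag n 1) (mixed_diag n 2 3) = 1"
    and "compat_degree (mixed_diag n 2 3) (long_diag n 1) = 2"
proof -
  have "1 \<le> (1::nat) \<and> 1 \<le> n + 1" "1 \<le> (2::nat) \<and> 2 < (3::nat) \<and> 3 \<le> n + 1 \<and> (2::nat, 3) \<noteq> (1, n + 1)"
    using assms by auto
  then have mem: "long_diag n 1 \<in> diag_classes n" "mixed_diag n 2 3 \<in> diag_classes n"
    unfolding diag_classes_def by blast+
  have "compat_degree (long_diag n 1) (mixed_diag n 2 3) =
      card {d \<in> long_diag n 1. crosses d {2, bar n 3}}"
    by (rule compat_degree_eq[OF mem]) (simp add: mixed_diag_def)
  also have "\<dots> = 1"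
    unfolding long_diag_def card_Collect_single using assms by (simp add: bar_def crosses_pair)
  finally show "compat_degree (long_diag n 1) (mixed_diag n 2 3) = 1" .
  have ne: "{2, bar n 3} \<noteq> {3, bar n 2}" by (auto simp: bar_def doubleton_eq_iff)
  have "compat_degree (mixed_diag n 2 3) (long_diag n 1) =
      card {d \<in> mixed_diag n 2 3. crosses d {1, bar n 1}}"
    by (rule compat_degree_eq[OF mem(2,1)]) (simp add: long_diag_def)
  also have "card {d \<in> mixed_diag n 2 3. crosses d {1, bar n 1}} = 2"
    unfolding mixed_diag_def card_Collect_pair[OF ne] using assms by (simp add: bar_def crosses_pair)
  finally show "compat_degree (mixed_diag n 2 3) (long_diag n 1) = 2" .
qed

end

theory Submission
  imports Defs
begin

text \<open>
  A point of the configuration space is a solution of the u-equations of the \<open>2h\<close>-gon, \<open>h = n + 1\<close>,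
  that is invariant under the half turn. Such solutions are the cross ratios of \<open>2h\<close> distinct points
  of the projective line such that some projective involution \<open>\<phi>\<close> maps the \<open>i\<close>-th point to the
  \<open>(i + h)\<close>-th, up to projective equivalence. Normalising the first point to \<open>\<infinity>\<close>, its image to \<open>0\<close> and
  the second point to \<open>1\<close> gives \<open>\<phi>(x) = a / x\<close>, so the space is the set of all \<open>(a, z\<^sub>3, \<dots>, z\<^sub>h)\<close>
  with \<open>z\<^sub>2 = 1\<close>, \<open>a \<noteq> 0\<close>, \<open>z\<^sub>i \<noteq> 0\<close>, \<open>z\<^sub>i\<^sup>2 \<noteq> a\<close>, \<open>z\<^sub>i \<noteq> z\<^sub>j\<close> and \<open>z\<^sub>i z\<^sub>j \<noteq> a\<close>. Forgetting the last
  coordinate \<open>z\<^sub>k\<^sub>+\<^sub>1\<close> is a fibration whose fibre is the affine line without the points \<open>0\<close>, \<open>z\<^sub>i\<close>,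
  \<open>a / z\<^sub>i\<close> (\<open>2 \<le> i \<le> k\<close>) and the square roots of \<open>a\<close>: these are \<open>2k + 1\<close> points if \<open>a\<close> is a
  square and \<open>2k - 1\<close> points otherwise. Both counts follow: over \<open>\<real>\<close>, removing \<open>r\<close> disjoint graphs
  multiplies the number of components by \<open>r + 1\<close>.
\<close>

section \<open>The extended u-equations\<close>

definition sprod :: "(nat \<Rightarrow> nat \<Rightarrow> 'a::comm_monoid_mult) \<Rightarrow> nat set \<Rightarrow> nat set \<Rightarrow> 'a"
  where "sprod V A B = (\<Prod>a\<in>A. \<Prod>b\<in>B. V a b)"

lemma sprod_empty [simp]: "sprod V {} B = 1" "sprod V A {} = 1"
  by (simp_all add: sprod_def)

lemma sprod_Un_left: "finite A \<Longrightarrow> finite A' \<Longrightarrow> A \<inter> A' = {} \<Longrightarrow> sprod V (A \<union> A') B = sprod V A B * sprod V A' B"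
  by (simp add: sprod_def prod.union_disjoint)

lemma sprod_Un_right: "finite B \<Longrightarrow> finite B' \<Longrightarrow> B \<inter> B' = {} \<Longrightarrow> sprod V A (B \<union> B') = sprod V A B * sprod V A B'"
  by (simp add: sprod_def prod.union_disjoint prod.distrib)

lemma sprod_single [simp]: "sprod V {a} {b} = V a b"
  by (simp add: sprod_def)

lemma sprod_commute: "(\<And>i j. V i j = V j i) \<Longrightarrow> sprod V A B = sprod V B A"
  unfolding sprod_def by (subst prod.swap) simp

lemma sprod_nonzero:
  fixes V :: "nat \<Rightarrow> nat \<Rightarrow> 'a::field"
  assumes "\<And>a b. a \<in> A \<Longrightarrow> b \<in> B \<Longrightarrow> V a b \<noteq> 0"
  shows "sprod V A B \<noteq> 0"
proof (cases "finite A \<and> finite B")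
  case True
  then show ?thesis using assms by (simp add: sprod_def prod_zero_iff)
next
  case False
  then show ?thesis by (cases "finite A") (auto simp: sprod_def)
qed

text \<open>Sides of the polygon are excluded; values of \<open>V\<close> at sides are arbitrary and never used.\<close>

definition nonadj :: "nat \<Rightarrow> nat \<Rightarrow> nat \<Rightarrow> bool"
  where "nonadj N i j \<longleftrightarrow> 1 \<le> i \<and> i + 2 \<le> j \<and> j \<le> N \<and> (i, j) \<noteq> (1, N)"

locale u_solution =
  fixes V :: "nat \<Rightarrow> nat \<Rightarrow> 'a::field" and N :: nat
  assumes sym: "V i j = V j i"
    and nonzero: "nonadj N i j \<Longrightarrow> V i j \<noteq> 0"
    and u_eq: "nonadj N i j \<Longrightarrow> V i j + sprod V {i<..<j} ({j<..N} \<union> {1..<i}) = 1"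
begin

lemma nonzero': "nonadj N j i \<Longrightarrow> V i j \<noteq> 0"
  using nonzero[of j i] sym[of i j] by simp

text \<open>
  The induction step for \<open>extended_u_eq\<close>: an arc opposite to the vertex \<open>a\<close> is split into \<open>{k}\<close> and
  \<open>c'\<close>, and the equation for \<open>a\<close> is obtained from that for its successor \<open>a'\<close>, which is absent when
  \<open>a'\<close> is next to \<open>k\<close>. A name like \<open>a'D\<close> stands for a product of values over \<open>{a'} \<times> D\<close>, where \<open>B\<close>
  is the arc between \<open>a'\<close> and \<open>k\<close> and \<open>D\<close> the one between \<open>c'\<close> and \<open>a\<close>; moreover \<open>e = a'c'\<close>,
  \<open>\<beta> = Bc'\<close>, \<open>\<delta> = kD\<close>.
\<close>

lemma extended_u_eq_step:
  assumes 1: "ac + e * a'D * \<beta> * BD = (1::'a)" and 2: "ac' + a'D * BD * \<delta> = 1"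
    and 4: "e + BD * \<delta> * Ba * ac = 1"
    and or: "(Ba = 1 \<and> BD = 1 \<and> \<beta> = 1) \<or> (a'c + \<beta> * BD * Ba = 1 \<and> a'c * e + Ba * BD = 1 \<and> Ba \<noteq> 0 \<and> BD \<noteq> 0)"
  shows "ac * ac' + a'D * BD = 1"
proof -
  \<comment> \<open>The equations at \<open>a'\<close> give \<open>key\<close> after multiplication
    by \<open>Ba * BD\<close>, which is nonzero and is cancelled. Substituted into \<open>1\<close>,
    \<open>key\<close> replaces \<open>\<beta> * e\<close> by \<open>1 - \<delta> * ac\<close>, and
    \<open>2\<close> then removes \<open>\<delta>\<close>.\<close>
  have key: "1 - \<beta> * e = \<delta> * ac"
    using or
  proof
    assume "Ba = 1 \<and> BD = 1 \<and> \<beta> = 1"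
    then show ?thesis using 4 by (simp add: algebra_simps)
  next
    assume *: "a'c + \<beta> * BD * Ba = 1 \<and> a'c * e + Ba * BD = 1 \<and> Ba \<noteq> 0 \<and> BD \<noteq> 0"
    have "(Ba * BD) * (1 - \<beta> * e - \<delta> * ac) = 0"
      using * 4 by algebra
    then show ?thesis using * by auto
  qed
  show ?thesis using key 1 2 by algebra
qed

text \<open>If \<open>{k..<l}\<close> is a single vertex, this is the u-equation itself; longer arcs
  are built up one vertex at a time. The sets \<open>{a}\<close>, \<open>{a<..<k}\<close>,
  \<open>{k..<l}\<close> and the remaining vertices are four consecutive arcs, and the two products
  over opposite arcs are complementary cross ratios.\<close>

lemma extended_u_eq:
  assumes "1 \<le> a" "a + 2 \<le> k" "k < l" "l \<le> N + 1" "a = 1 \<Longrightarrow> l \<le> N"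
  shows "sprod V {a} {k..<l} + sprod V {a<..<k} ({l..N} \<union> {1..<a}) = 1"
  using assms
\<comment> \<open>The measure is \<open>(l - k) + (l - a)\<close>: it drops when \<open>k\<close> or
  \<open>a\<close> increases and when \<open>l\<close> is lowered to \<open>k + 1\<close>, which
  covers all five uses of the hypothesis.\<close>
proof (induction "2 * l - k - a" arbitrary: a k l rule: less_induct)
  case less
  note a = less.prems
  show ?case
  proof (cases "l = k + 1")
    case True
    then have "{k..<l} = {k}" "{l..N} = {k<..N}" by auto
    moreover have "nonadj N a k" using a True by (auto simp: nonadj_def)
    ultimately show ?thesis using u_eq[of a k] by simp
  next
    case False
    define a' where "a' = a + 1"
    define B where "B = {a'<..<k}"
    define D where "D = {l..N} \<union> {1..<a}"
    define c' where "c' = {k+1..<l}"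
    have fin: "finite B" "finite D" "finite c'" by (auto simp: B_def D_def c'_def)
    have s: "{a<..<k} = {a'} \<union> B" "{k..<l} = {k} \<union> c'" "{k+1..N} \<union> {1..<a} = c' \<union> D"
      "{a<..<k+1} = {a'} \<union> B \<union> {k}" "{k..<k+1} = {k}" "{k+1..N} \<union> {1..<a'} = c' \<union> D \<union> {a}"
      "{l..N} \<union> {1..<a'} = D \<union> {a}" "{a'<..<k+1} = B \<union> {k}" "{a'<..<k} = B" "{l..N} \<union> {1..<a} = D" "{k+1..<l} = c'"
      if "a' < k"
      using False a that by (auto simp: B_def D_def c'_def a'_def)
    have d: "{a'} \<inter> B = {}" "{k} \<inter> c' = {}" "c' \<inter> D = {}" "({a'} \<union> B) \<inter> {k} = {}" "(c' \<union> D) \<inter> {a} = {}"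
      "D \<inter> {a} = {}" "B \<inter> {k} = {}" "a \<notin> D" "a \<notin> c'" "a' \<notin> B" "k \<notin> B"
      using False a by (auto simp: B_def D_def c'_def a'_def)
    note [simp del] = Un_insert_left Un_insert_right
    note split = sprod_Un_left sprod_Un_right fin d
    have a'k: "a' < k" using a by (simp add: a'_def)
    note s = s[OF a'k]
    have 1: "V a k + sprod V {a'} c' * sprod V {a'} D * sprod V B c' * sprod V B D = 1"
      using less.hyps[of "k+1" k a] a False unfolding s
      by (simp add: split mult_ac)
    have 2: "sprod V {a} c' + sprod V {a'} D * sprod V B D * sprod V {k} D = 1"
      using less.hyps[of l "k+1" a] a False unfolding s
      by (simp add: split mult_ac)
    have 4: "sprod V {a'} c' + sprod V B D * sprod V {k} D * sprod V B {a} * V a k = 1"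
      using less.hyps[of l "k+1" a'] a False a'k unfolding s
      by (simp add: split mult_ac a'_def[symmetric] sym[of k a]) (auto simp: a'_def)
    have "V a k * sprod V {a} c' + sprod V {a'} D * sprod V B D = 1"
    proof (rule extended_u_eq_step[where \<beta> = "sprod V B c'" and a'c = "V a' k", OF _ 2 4])
      show "V a k + sprod V {a'} c' * sprod V {a'} D * sprod V B c' * sprod V B D = 1"
        using 1 by simp
    next
      show "sprod V B {a} = 1 \<and> sprod V B D = 1 \<and> sprod V B c' = 1 \<or>
        V a' k + sprod V B c' * sprod V B D * sprod V B {a} = 1 \<and>
        V a' k * sprod V {a'} c' + sprod V B {a} * sprod V B D = 1 \<and> sprod V B {a} \<noteq> 0 \<and> sprod V B D \<noteq> 0"
      proof (cases "a' + 1 = k")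
        case True
        then have "B = {}" by (auto simp: B_def)
        then show ?thesis by simp
      next
        case ne: False
        have "V a' k + sprod V B c' * sprod V B D * sprod V B {a} = 1"
          using less.hyps[of "k+1" k a'] a False a'k ne unfolding s
          by (simp add: split mult_ac) (auto simp: a'_def)
        moreover have "V a' k * sprod V {a'} c' + sprod V B {a} * sprod V B D = 1"
          using less.hyps[of l k a'] a False a'k ne unfolding s
          by (simp add: split mult_ac) (auto simp: a'_def)
        moreover have "sprod V B {a} \<noteq> 0"
          by (rule sprod_nonzero, rule nonzero') (use a in \<open>auto simp: B_def a'_def nonadj_def\<close>)
        moreover have "V x y \<noteq> 0" if "x \<in> B" "y \<in> D" for x y
          using that nonzero[of x y] nonzero'[of y x] a False
          by (cases "y < x") (auto simp: B_def D_def a'_def nonadj_def)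
        then have "sprod V B D \<noteq> 0" by (rule sprod_nonzero)
        ultimately show ?thesis by blast
      qed
    qed
    then show ?thesis unfolding s by (simp add: split)
  qed
qed

end

section \<open>Cross ratios of centrally symmetric configurations\<close>

text \<open>Points of the projective line are given by homogeneous coordinates.\<close>

definition br :: "'a::field \<times> 'a \<Rightarrow> 'a \<times> 'a \<Rightarrow> 'a"
  where "br p q = fst p * snd q - fst q * snd p"

definition cross_ratio :: "(nat \<Rightarrow> 'a::field \<times> 'a) \<Rightarrow> nat \<Rightarrow> nat \<Rightarrow> 'a"
  where "cross_ratio P i j =
    br (P i) (P (j + 1)) * br (P (i + 1)) (P j) / (br (P i) (P j) * br (P (i + 1)) (P (j + 1)))"

lemma br_commute: "br p q = - br q p"
  by (simp add: br_def)

lemma cross_ratio_commute: "cross_ratio P i j = cross_ratio P j i"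
  unfolding cross_ratio_def
  using br_commute[of "P i" "P j"] br_commute[of "P i" "P (j + 1)"]
    br_commute[of "P (i + 1)" "P j"] br_commute[of "P (i + 1)" "P (j + 1)"]
  by (simp add: mult_ac)

text \<open>\<open>y\<close> and \<open>w\<close> may vanish: division by zero then makes both sides
  0.\<close>

lemma quotient_telescope:
  fixes a b :: "'a::field"
  assumes "a \<noteq> 0" "b \<noteq> 0"
  shows "a * x / (y * b) * (z * b / (a * w)) = z * x / (y * w)"
  using assms by (cases "y = 0 \<or> w = 0") (auto simp: field_simps)

text \<open>Telescoping, first along each row and then over the rows: only the brackets at the four
  corners survive, so a rectangle of consecutive indices again gives one cross ratio.\<close>

lemma sprod_cross_ratio:
  assumes "i \<le> j" "k \<le> l" and nz: "\<And>s t. s \<in> {i..j} \<Longrightarrow> t \<in> {k..l} \<Longrightarrow> br (P s) (P t) \<noteq> 0"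
  shows "sprod (cross_ratio P) {i..<j} {k..<l} =
    br (P i) (P l) * br (P j) (P k) / (br (P i) (P k) * br (P j) (P l))"
proof -
  have row: "(\<Prod>t\<in>{k..<l}. cross_ratio P s t) =
      br (P s) (P l) * br (P (s + 1)) (P k) / (br (P s) (P k) * br (P (s + 1)) (P l))"
    if s: "s \<in> {i..<j}" for s
    using \<open>k \<le> l\<close> nz
  proof (induction l rule: dec_induct)
    case base
    then show ?case using s by simp
  next
    case (step m)
    have "(\<Prod>t\<in>{k..<m}. cross_ratio P s t) =
        br (P s) (P m) * br (P (s + 1)) (P k) / (br (P s) (P k) * br (P (s + 1)) (P m))"
      by (rule step.IH) (use step.prems in auto)
    moreover have "br (P s) (P m) \<noteq> 0" "br (P (s + 1)) (P m) \<noteq> 0"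
      using step.prems[of s m] step.prems[of "s + 1" m] step.hyps s by auto
    ultimately show ?case
      using step.hyps quotient_telescope[of "br (P s) (P m)" "br (P (s + 1)) (P m)"]
      by (simp add: cross_ratio_def)
  qed
  have "(\<Prod>s\<in>{i..<j}. br (P s) (P l) * br (P (s + 1)) (P k) / (br (P s) (P k) * br (P (s + 1)) (P l))) =
      br (P i) (P l) * br (P j) (P k) / (br (P i) (P k) * br (P j) (P l))"
    using \<open>i \<le> j\<close> nz
  proof (induction j rule: dec_induct)
    case base
    then show ?case using \<open>k \<le> l\<close> by simp
  next
    case (step m)
    have "(\<Prod>s\<in>{i..<m}. br (P s) (P l) * br (P (s + 1)) (P k) / (br (P s) (P k) * br (P (s + 1)) (P l))) =
      br (P i) (P l) * br (P m) (P k) / (br (P i) (P k) * br (P m) (P l))"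
      by (rule step.IH) (use step.prems in auto)
    moreover have "br (P m) (P l) \<noteq> 0" "br (P m) (P k) \<noteq> 0"
      using step.prems[of m l] step.prems[of m k] step.hyps \<open>k \<le> l\<close> by auto
    ultimately show ?case
      using step.hyps quotient_telescope[of "br (P m) (P k)" "br (P m) (P l)"] by (simp add: mult_ac)
  qed
  then show ?thesis unfolding sprod_def using row by simp
qed

text \<open>The values on the diagonals crossing \<open>(i, j)\<close> telescope to the
  complementary cross ratio of the same four points, and the two sum to 1 by the three-term Pluecker
  relation. As \<open>P (N + 1)\<close> and \<open>P 1\<close> are the same projective point, the
  arcs on both sides of \<open>N\<close> join.\<close>

lemma u_solution_cross_ratio:
  assumes nz: "\<And>i j. 1 \<le> i \<Longrightarrow> i < j \<Longrightarrow> j \<le> N \<Longrightarrow> br (P i) (P j) \<noteq> 0"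
    and closed: "P (N + 1) = (c * fst (P 1), c * snd (P 1))" and c: "c \<noteq> 0"
  shows "u_solution (cross_ratio P) N"
proof
  show "cross_ratio P i j = cross_ratio P j i" for i j by (rule cross_ratio_commute)
  have brN: "br q (P (N + 1)) = c * br q (P 1)" for q
    unfolding closed by (simp add: br_def algebra_simps)
  have nz': "br (P i) (P j) \<noteq> 0" if "1 \<le> i" "i \<noteq> j" "1 \<le> j" "i \<le> N" "j \<le> N + 1" "i = 1 \<Longrightarrow> j \<le> N" for i j
  proof (cases "j = N + 1")
    case True
    then have "i \<noteq> 1" using that by auto
    then show ?thesis unfolding True brN using nz[of 1 i] that br_commute[of "P i" "P 1"] c by auto
  next
    case False
    then show ?thesis using that nz[of i j] nz[of j i] br_commute[of "P i" "P j"] by (cases "i < j") auto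
  qed
  fix i j assume na: "nonadj N i j"
  then have ij: "1 \<le> i" "i + 2 \<le> j" "j \<le> N" "i = 1 \<Longrightarrow> j < N" by (auto simp: nonadj_def)
  have nzs: "br (P i) (P (j+1)) \<noteq> 0" "br (P (i+1)) (P j) \<noteq> 0" "br (P i) (P j) \<noteq> 0"
    "br (P (i+1)) (P (j+1)) \<noteq> 0" "br (P (i+1)) (P 1) \<noteq> 0" "br (P j) (P 1) \<noteq> 0"
    by (rule nz'; use ij in linarith)+
  then show "cross_ratio P i j \<noteq> 0"
    unfolding cross_ratio_def by (metis divide_eq_0_iff mult_eq_0_iff)
  have *: "{i<..<j} = {i+1..<j}" "{j<..N} = {j+1..<N+1}" by auto
  have 1: "sprod (cross_ratio P) {i+1..<j} {j+1..<N+1} =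
      br (P (i+1)) (P (N+1)) * br (P j) (P (j+1)) / (br (P (i+1)) (P (j+1)) * br (P j) (P (N+1)))"
    using ij by (intro sprod_cross_ratio nz') auto
  have 2: "sprod (cross_ratio P) {i+1..<j} {1..<i} =
      br (P (i+1)) (P i) * br (P j) (P 1) / (br (P (i+1)) (P 1) * br (P j) (P i))"
    using ij by (intro sprod_cross_ratio nz') auto
  have "sprod (cross_ratio P) {i<..<j} ({j<..N} \<union> {1..<i}) =
      br (P (i+1)) (P i) * br (P j) (P (j+1)) / (br (P (i+1)) (P (j+1)) * br (P j) (P i))"
  proof -
    have "sprod (cross_ratio P) {i+1..<j} {j+1..<N+1} =
        br (P (i+1)) (P 1) * br (P j) (P (j+1)) / (br (P (i+1)) (P (j+1)) * br (P j) (P 1))"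
      unfolding 1 brN using c by simp
    moreover have "sprod (cross_ratio P) {i<..<j} ({j<..N} \<union> {1..<i}) =
        sprod (cross_ratio P) {i+1..<j} {j+1..<N+1} * sprod (cross_ratio P) {i+1..<j} {1..<i}"
      unfolding * using ij by (intro sprod_Un_right) auto
    ultimately show ?thesis using quotient_telescope[OF nzs(5,6)] 2 by metis
  qed
  moreover have "br p q' * br p' q / (br p q * br p' q') + br p' p * br q q' / (br p' q' * br q p) = 1"
    if "br p q \<noteq> 0" "br p' q' \<noteq> 0" for p q p' q' :: "'a \<times> 'a"
  proof -
    have "br p q' * br p' q - br p' p * br q q' = br p q * br p' q'"
      by (simp add: br_def algebra_simps)
    moreover have "br p' p * br q q' / (br p' q' * br q p) = - (br p' p * br q q') / (br p q * br p' q')"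
      using br_commute[of q p] by (simp add: mult.commute)
    ultimately show ?thesis using that by (simp add: diff_divide_distrib[symmetric])
  qed
  ultimately show "cross_ratio P i j + sprod (cross_ratio P) {i<..<j} ({j<..N} \<union> {1..<i}) = 1"
    unfolding cross_ratio_def using nzs by simp
qed

lemma cross_ratio_scale:
  assumes "\<And>j. j \<in> {i, i+1, k, k+1} \<Longrightarrow> P' j = (s j * fst (P j), s j * snd (P j)) \<and> s j \<noteq> 0"
  shows "cross_ratio P' i k = cross_ratio P i k"
proof -
  have "br (P' x) (P' y) = s x * s y * br (P x) (P y)" if "x \<in> {i, i+1}" "y \<in> {k, k+1}" for x y
    using assms[of x] assms[of y] that by (auto simp: br_def algebra_simps)
  moreover have "s i \<noteq> 0" "s (i+1) \<noteq> 0" "s k \<noteq> 0" "s (k+1) \<noteq> 0" using assms by auto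
  ultimately show ?thesis unfolding cross_ratio_def
    by (simp add: divide_simps)
qed

text \<open>The involution \<open>x \<mapsto> a / x\<close> in homogeneous coordinates.\<close>

definition inv_pt :: "'a::field \<Rightarrow> 'a \<times> 'a \<Rightarrow> 'a \<times> 'a"
  where "inv_pt a p = (a * snd p, fst p)"

lemma br_inv_pt: "br (inv_pt a p) (inv_pt a q) = - a * br p q"
  by (simp add: br_def inv_pt_def algebra_simps)

lemma inv_pt_inv_pt: "inv_pt a (inv_pt a p) = (a * fst p, a * snd p)"
  by (simp add: inv_pt_def)

text \<open>
  The coordinate \<open>z 1\<close> is the parameter \<open>a\<close> of the involution and not a point: the first point is
  \<open>\<infinity>\<close>. Indices beyond \<open>2h\<close> continue periodically up to scaling.
\<close>

definition pts :: "nat \<Rightarrow> (nat \<Rightarrow> 'a::field) \<Rightarrow> nat \<Rightarrow> 'a \<times> 'a"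
  where "pts h z j = (inv_pt (z 1) ^^ ((j - 1) div h))
    (if (j - 1) mod h = 0 then (1, 0) else (z ((j - 1) mod h + 1), 1))"

lemma pts_1: "h \<ge> 1 \<Longrightarrow> pts h z 1 = (1, 0)" "h \<ge> 1 \<Longrightarrow> pts h z (Suc 0) = (1, 0)"
  by (simp_all add: pts_def)

lemma pts_base: "2 \<le> j \<Longrightarrow> j \<le> h \<Longrightarrow> pts h z j = (z j, 1)"
  by (cases j) (auto simp add: pts_def)

lemma pts_shift:
  assumes "h \<ge> 1" "j \<ge> 1"
  shows "pts h z (j + h) = inv_pt (z 1) (pts h z j)"
proof -
  obtain m where "j = Suc m" using assms by (cases j) auto
  then show ?thesis using assms by (simp add: pts_def)
qed

text \<open>No point is fixed by the involution, and none equals another one or its image.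
  Coordinates outside \<open>{1..k}\<close> are 0, so that all \<open>k\<close> share one function
  type and forgetting a coordinate means setting it to 0.\<close>

definition sym_configs :: "nat \<Rightarrow> (nat \<Rightarrow> 'a::field) set"
  where "sym_configs k = {z. z 2 = 1 \<and> z 1 \<noteq> 0 \<and> (\<forall>j\<in>{2..k}. z j \<noteq> 0 \<and> z j * z j \<noteq> z 1) \<and>
    (\<forall>i j. 2 \<le> i \<longrightarrow> i < j \<longrightarrow> j \<le> k \<longrightarrow> z i \<noteq> z j \<and> z i * z j \<noteq> z 1) \<and> (\<forall>j. j \<notin> {1..k} \<longrightarrow> z j = 0)}"

lemma pts_cases:
  assumes "1 \<le> j" "j \<le> h"
  shows "j = 1 \<and> pts h z j = (1, 0) \<or> 2 \<le> j \<and> pts h z j = (z j, 1)"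
  using assms pts_1[of h z] pts_base[of j h z] by (cases "j = 1") auto

text \<open>The half turn reduces the claim to two indices in the first half or one in each half:
  shifting both indices multiplies the bracket by \<open>- z 1\<close>.\<close>

lemma br_pts_nonzero:
  assumes z: "z \<in> sym_configs h" and ij: "1 \<le> i" "i < j" "j \<le> 2 * h"
  shows "br (pts h z i) (pts h z j) \<noteq> 0"
proof -
  have low: "br (pts h z i) (pts h z j) \<noteq> 0" if "1 \<le> i" "i < j" "j \<le> h" for i j
    using that z pts_cases[of i h z] pts_cases[of j h z] by (auto simp: br_def sym_configs_def)
  have a: "z 1 \<noteq> 0" using z by (simp add: sym_configs_def)
  have prod: "z i * z j \<noteq> z 1" if "2 \<le> i" "i \<le> h" "2 \<le> j" "j \<le> h" for i j
  proof -
    have "z i * z j \<noteq> z 1" if "2 \<le> i" "i < j" "j \<le> h" for i j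
      using that z by (simp add: sym_configs_def)
    moreover have "z i * z i \<noteq> z 1" using that z by (simp add: sym_configs_def)
    ultimately show ?thesis using that mult.commute[of "z i" "z j"]
      by (cases i j rule: linorder_cases) metis+
  qed
  have mixed: "br (pts h z i) (inv_pt (z 1) (pts h z j)) \<noteq> 0" if "1 \<le> i" "i \<le> h" "1 \<le> j" "j \<le> h" for i j
    using that z prod[of i j] pts_cases[of i h z] pts_cases[of j h z]
    by (auto simp: br_def inv_pt_def sym_configs_def)
  consider "j \<le> h" | "i \<le> h" "h < j" | "h < i" by linarith
  then show ?thesis
  proof cases
    case 1
    then show ?thesis using low ij by blast
  next
    case 2
    then show ?thesis using mixed[of i "j - h"] pts_shift[of h "j - h" z] ij by simp
  next
    case 3
    then show ?thesis using low[of "i - h" "j - h"] pts_shift[of h "j - h" z] pts_shift[of h "i - h" z] ij a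
      by (simp add: br_inv_pt)
  qed
qed

text \<open>Applying the involution twice multiplies homogeneous coordinates by \<open>z 1\<close>,
  so after \<open>2 * h\<close> steps the points close up projectively.\<close>

lemma pts_close:
  assumes "h \<ge> 1" "j \<ge> 1"
  shows "pts h z (j + 2 * h) = (z 1 * fst (pts h z j), z 1 * snd (pts h z j))"
  using pts_shift[OF assms(1), of "j + h" z] pts_shift[OF assms, of z] assms
  by (simp add: inv_pt_inv_pt mult_2 add.assoc)

lemma u_solution_pts:
  assumes "z \<in> sym_configs h" "h \<ge> 1"
  shows "u_solution (cross_ratio (pts h z)) (2 * h)"
proof (rule u_solution_cross_ratio)
  show "pts h z (2 * h + 1) = (z 1 * fst (pts h z 1), z 1 * snd (pts h z 1))"
    using pts_close[of h 1 z] assms by (simp add: add.commute)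
qed (use br_pts_nonzero[OF assms(1)] assms in \<open>auto simp: sym_configs_def\<close>)

lemma cross_ratio_pts_shift:
  assumes "h \<ge> 1" "i \<ge> 1" "j \<ge> 1" "z 1 \<noteq> 0"
  shows "cross_ratio (pts h z) (i + h) (j + h) = cross_ratio (pts h z) i j"
proof -
  have "pts h z (Suc (k + h)) = inv_pt (z 1) (pts h z (Suc k))" for k
    using pts_shift[OF assms(1), of "Suc k" z] by simp
  then show ?thesis using assms pts_shift[OF assms(1,2), of z] pts_shift[OF assms(1,3), of z] unfolding cross_ratio_def
    by (simp add: br_inv_pt)
qed

lemma cross_ratio_pts_close:
  assumes "h \<ge> 1" "i \<ge> 1" "j \<ge> 1" "z 1 \<noteq> 0"
  shows "cross_ratio (pts h z) i (j + 2 * h) = cross_ratio (pts h z) i j"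
proof -
  have "pts h z (Suc (j + 2 * h)) = (z 1 * fst (pts h z (Suc j)), z 1 * snd (pts h z (Suc j)))"
    using pts_close[OF assms(1), of "Suc j" z] by simp
  moreover have "br p (c * x, c * y) = c * br p (x, y)" for p :: "'a \<times> 'a" and c x y
    by (simp add: br_def algebra_simps)
  ultimately show ?thesis using assms pts_close[OF assms(1), of j z] unfolding cross_ratio_def
    by simp
qed

section \<open>Reconstruction of the points from a solution of the u-equations\<close>

text \<open>These are telescoped cross ratios of the normalised points. The product for
  \<open>j\<close> involves the points \<open>2\<close>, \<open>j\<close>, \<open>h + 1\<close> and
  \<open>2 * h + 1\<close>, that is \<open>1\<close>, \<open>z j\<close>, \<open>0\<close> and
  infinity, and equals \<open>z j\<close>. For \<open>j = 1\<close> the product is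
  \<open>- a / (1 - a)\<close> and the divisor is \<open>1 / (1 - a)\<close>.\<close>

definition config_of_u :: "nat \<Rightarrow> (nat \<Rightarrow> nat \<Rightarrow> 'a::field) \<Rightarrow> nat \<Rightarrow> 'a"
  where "config_of_u h V j =
    (if j = 1 then - sprod V {2..<h+1} {h+2..<2*h+1} / V 1 (h + 1)
     else if 2 \<le> j \<and> j \<le> h then sprod V {2..<j} {h+1..<2*h+1} else 0)"

locale sym_u_solution = u_solution V "2 * h" for V :: "nat \<Rightarrow> nat \<Rightarrow> 'a::field" and h +
  assumes h2: "h \<ge> 2"
    and inv: "1 \<le> i \<Longrightarrow> i \<le> h \<Longrightarrow> 1 \<le> j \<Longrightarrow> j \<le> h \<Longrightarrow> V i (j + h) = V (i + h) j"
begin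

text \<open>
  With the first point at \<open>\<infinity>\<close>, the second at \<open>0\<close> and the third at \<open>1\<close>, the \<open>j\<close>-th point is
  \<open>1 / Q j\<close>; the affine change of coordinates sending the points \<open>2\<close> and \<open>h + 1\<close> to \<open>1\<close> and \<open>0\<close>
  turns it into \<open>\<zeta> j\<close>. The case \<open>j = 2\<close> is separate because \<open>Q 2\<close> is the empty product.
\<close>

definition Q :: "nat \<Rightarrow> 'a" where "Q j = sprod V {1} {3..<j}"
definition F :: "nat \<Rightarrow> nat \<Rightarrow> 'a" where "F j k = sprod V {2..<j} {k..<2*h+1}"
definition \<zeta> :: "nat \<Rightarrow> 'a" where "\<zeta> j = (if j = 2 then 1 else 1 - Q (h + 1) / Q j)"
definition c :: "nat \<Rightarrow> 'a" where "c j = Q (h + 1) / Q j"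

lemma sprod_split_right:
  assumes "i \<le> j" "j \<le> k"
  shows "sprod V A {i..<k} = sprod V A {i..<j} * sprod V A {j..<k}"
  using sprod_Un_right[of "{i..<j}" "{j..<k}" V A] assms by (simp add: ivl_disj_un_two)

lemma sprod_split_left:
  assumes "i \<le> j" "j \<le> k"
  shows "sprod V {i..<k} A = sprod V {i..<j} A * sprod V {j..<k} A"
  using sprod_Un_left[of "{i..<j}" "{j..<k}" V A] assms by (simp add: ivl_disj_un_two)

lemma Q_nonzero: "3 \<le> j \<Longrightarrow> j \<le> 2 * h \<Longrightarrow> Q j \<noteq> 0"
  unfolding Q_def by (rule sprod_nonzero, rule nonzero) (auto simp: nonadj_def)

lemma Q_split: "3 \<le> j \<Longrightarrow> j \<le> k \<Longrightarrow> Q k = Q j * sprod V {1} {j..<k}"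
  unfolding Q_def by (rule sprod_split_right)

lemma F_nonzero: "2 \<le> j \<Longrightarrow> j < k \<Longrightarrow> F j k \<noteq> 0"
  unfolding F_def by (rule sprod_nonzero, rule nonzero) (auto simp: nonadj_def)

lemma c_nonzero: "3 \<le> j \<Longrightarrow> j \<le> 2 * h \<Longrightarrow> c j \<noteq> 0"
  using Q_nonzero[of j] Q_nonzero[of "h+1"] h2 by (simp add: c_def)

lemma F_eq:
  assumes "3 \<le> j" "j < k" "k \<le> 2 * h"
  shows "F j k = 1 - Q k / Q j"
proof -
  have "sprod V {1} {j..<k} + F j k = 1"
  proof -
    have *: "{1<..<j} = {2..<j}" "{k..2*h} \<union> {1..<1} = {k..<2*h+1}" by auto
    then show ?thesis using extended_u_eq[of 1 j k] assms unfolding F_def * by simp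
  qed
  moreover have "sprod V {1} {j..<k} = Q k / Q j"
    using Q_split[of j k] Q_nonzero[of j] assms by simp
  ultimately show ?thesis by (simp add: eq_diff_eq add.commute)
qed

text \<open>Differences of points factor into values of \<open>V\<close>, so they are nonzero, and
  the factors \<open>c\<close> cancel from cross ratios. For \<open>i = 2\<close> the product
  \<open>F\<close> is empty.\<close>

lemma \<zeta>_diff:
  assumes "2 \<le> i" "i < j" "j \<le> 2 * h"
  shows "\<zeta> i - \<zeta> j = c j * F i j"
proof (cases "i = 2")
  case True
  then show ?thesis using assms by (simp add: \<zeta>_def c_def F_def)
next
  case False
  then have "F i j = 1 - Q j / Q i" "Q i \<noteq> 0" "Q j \<noteq> 0"
    using assms F_eq[of i j] Q_nonzero[of i] Q_nonzero[of j] by auto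
  then show ?thesis using assms False by (simp add: \<zeta>_def c_def right_diff_distrib)
qed

lemma \<zeta>_ne: "2 \<le> i \<Longrightarrow> i < j \<Longrightarrow> j \<le> 2 * h \<Longrightarrow> \<zeta> i \<noteq> \<zeta> j"
  using \<zeta>_diff[of i j] c_nonzero[of j] F_nonzero[of i j] by auto

lemma V_F:
  assumes "2 \<le> m" "m + 2 \<le> l" "l \<le> 2 * h"
  shows "V m l = F m (l + 1) * F (m + 1) l / (F m l * F (m + 1) (l + 1))"
proof -
  have 1: "F (m + 1) k = F m k * sprod V {m} {k..<2*h+1}" for k
    unfolding F_def using sprod_split_left[of 2 m "m + 1" "{k..<2*h+1}"] assms by simp
  have "sprod V {m} {l..<2*h+1} = V m l * sprod V {m} {l+1..<2*h+1}"
    using sprod_split_right[of l "l + 1" "2*h+1" "{m}"] assms by simp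
  moreover have "sprod V {m} {l+1..<2*h+1} \<noteq> 0"
    by (rule sprod_nonzero, rule nonzero) (use assms in \<open>auto simp: nonadj_def\<close>)
  ultimately show ?thesis
    unfolding 1 using F_nonzero[of m l] F_nonzero[of m "l+1"] assms by simp
qed

lemma \<zeta>_zero: "\<zeta> (h + 1) = 0"
  using Q_nonzero[of "h+1"] h2 by (simp add: \<zeta>_def)

lemma config_eq_\<zeta>: "2 \<le> j \<Longrightarrow> j \<le> h \<Longrightarrow> config_of_u h V j = \<zeta> j"
  using \<zeta>_diff[of j "h+1"] Q_nonzero[of "h+1"] \<zeta>_zero
  by (auto simp: config_of_u_def F_def c_def)

lemma c_bar: "c (h + 2) = 1 / V 1 (h + 1)"
  using Q_split[of "h+1" "h+2"] Q_nonzero[of "h+1"] h2 by (simp add: c_def)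

lemma \<zeta>_bar_F:
  assumes "2 \<le> i" "i \<le> h"
  shows "\<zeta> (i + h) = - c (i + h) * F (h + 1) (i + h)"
  using \<zeta>_diff[of "h+1" "i+h"] \<zeta>_zero assms by (simp add: neg_eq_iff_add_eq_0 add_eq_0_iff)

text \<open>The second point is 1, so its image \<open>a / 1\<close> under the involution, the point
  of index \<open>h + 2\<close>, is the parameter.\<close>

lemma config_1: "config_of_u h V 1 = \<zeta> (h + 2)"
  using \<zeta>_bar_F[of 2] h2 c_bar by (simp add: config_of_u_def F_def add.commute)

text \<open>Here invariance under the half turn enters: it carries the block
  \<open>{1..<h+1} \<times> {h+2..<j+h}\<close> to \<open>{h+1..<2*h+1} \<times> {2..<j}\<close>,
  whose product is \<open>\<zeta> j\<close>. Splitting \<open>Q\<close> and \<open>F\<close> at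
  \<open>j + h\<close> shows that the first block is also the quotient of the points
  \<open>h + 2\<close> and \<open>j + h\<close>.\<close>

lemma \<zeta>_bar:
  assumes "2 \<le> j" "j \<le> h"
  shows "\<zeta> j * \<zeta> (j + h) = \<zeta> (h + 2)"
proof -
  define S where "S = sprod V {2..<h+1} {h+2..<j+h}"
  define T where "T = sprod V {1} {h+2..<j+h}"
  have T: "T \<noteq> 0" unfolding T_def
    by (rule sprod_nonzero, rule nonzero) (use assms in \<open>auto simp: nonadj_def\<close>)
  have "T * S = sprod V {1..<h+1} {h+2..<j+h}"
    using sprod_split_left[of 1 2 "h+1"] h2 by (simp add: T_def S_def numeral_2_eq_2)
  also have "\<dots> = (\<Prod>a\<in>{1..<h+1}. \<Prod>b\<in>{2..<j}. V a (b + h))"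
    unfolding sprod_def
  proof (rule prod.cong[OF refl])
    show "prod (V a) {h+2..<j+h} = (\<Prod>b\<in>{2..<j}. V a (b + h))" for a
      using prod.shift_bounds_nat_ivl[of "V a" 2 h j] by (simp add: add.commute)
  qed
  also have "\<dots> = (\<Prod>a\<in>{1..<h+1}. \<Prod>b\<in>{2..<j}. V (a + h) b)"
    using assms by (intro prod.cong refl inv) auto
  also have "\<dots> = sprod V {h+1..<2*h+1} {2..<j}"
    unfolding sprod_def using prod.shift_bounds_nat_ivl[of "\<lambda>a. \<Prod>b\<in>{2..<j}. V a b" 1 h "h+1"]
    by (simp add: mult_2 add.commute)
  also have "\<dots> = F j (h + 1)" unfolding F_def by (rule sprod_commute[OF sym])
  also have "\<dots> = \<zeta> j"
    using \<zeta>_diff[of j "h+1"] \<zeta>_zero assms Q_nonzero[of "h+1"] by (simp add: c_def)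
  finally have TS: "\<zeta> j = T * S" ..
  have "F (h + 1) (h + 2) = S * F (h + 1) (j + h)"
    unfolding F_def S_def using sprod_split_right[of "h+2" "j+h" "2*h+1"] assms by simp
  moreover have "c (h + 2) = c (j + h) * T"
    using Q_split[of "h+2" "j+h"] T assms h2 by (simp add: c_def T_def)
  ultimately show ?thesis
    using \<zeta>_bar_F[of 2] \<zeta>_bar_F[OF assms] TS h2 by (simp add: mult_ac add.commute)
qed

lemma config_in: "config_of_u h V \<in> sym_configs h"
proof -
  let ?z = "config_of_u h V"
  have a: "?z 1 \<noteq> 0" using \<zeta>_ne[of "h+1" "h+2"] h2 \<zeta>_zero config_1 by simp
  have ne: "?z j \<noteq> 0" if "2 \<le> j" "j \<le> h" for j
    using \<zeta>_ne[of j "h+1"] \<zeta>_zero config_eq_\<zeta>[OF that] that by simp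
  have prod: "?z i * ?z j \<noteq> ?z 1" if "2 \<le> i" "i \<le> h" "2 \<le> j" "j \<le> h" for i j
  proof -
    have "\<zeta> j * \<zeta> i \<noteq> \<zeta> j * \<zeta> (j + h)"
      using \<zeta>_ne[of i "j+h"] ne[of j] config_eq_\<zeta>[of j] that by simp
    then show ?thesis using that \<zeta>_bar[of j] config_eq_\<zeta> config_1 by (simp add: mult.commute)
  qed
  have "?z i \<noteq> ?z j" if "2 \<le> i" "i < j" "j \<le> h" for i j
    using \<zeta>_ne[of i j] config_eq_\<zeta> that by simp
  moreover have "?z 2 = 1" using config_eq_\<zeta>[of 2] h2 by (simp add: \<zeta>_def)
  moreover have "?z j = 0" if "j \<notin> {1..h}" for j using that h2 by (auto simp: config_of_u_def)
  ultimately show ?thesis unfolding sym_configs_def using a ne prod by (simp del: One_nat_def)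
qed

text \<open>Up to scaling, \<open>pts\<close> of the reconstructed configuration lists infinity
  followed by the points \<open>\<zeta> j\<close>, so its cross ratios are quotients of differences
  of \<open>\<zeta>\<close>, which factor through \<open>F\<close>.\<close>

lemma V_eq_cross_ratio:
  assumes "nonadj (2 * h) m l"
  shows "V m l = cross_ratio (pts h (config_of_u h V)) m l"
proof -
  let ?z = "config_of_u h V"
  define P where "P j = (if j = 1 \<or> j = 2 * h + 1 then (1, 0) else (\<zeta> j, 1 :: 'a))" for j
  have "cross_ratio (pts h ?z) m l = cross_ratio P m l"
  \<comment> \<open>The involution sends \<open>(z, 1)\<close> to
    \<open>(a, z) = z * (a / z, 1)\<close>, hence the factor \<open>?z (j - h)\<close> in the second
    half. The closing point is \<open>a\<close> times the first.\<close>
  proof (rule cross_ratio_scale[where s = "\<lambda>j. if j = 2 * h + 1 then ?z 1 else if j \<le> h + 1 then 1 else ?z (j - h)"])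
    fix j assume "j \<in> {m, m+1, l, l+1}"
    then have j: "1 \<le> j" "j \<le> 2 * h + 1" using assms by (auto simp: nonadj_def)
    have h1: "h \<ge> 1" using h2 by simp
    note z = config_in[unfolded sym_configs_def]
    consider "j = 1" | "2 \<le> j" "j \<le> h" | "j = h + 1" | "h + 2 \<le> j" "j \<le> 2 * h" | "j = 2 * h + 1"
      using j by linarith
    then show "pts h ?z j = ((if j = 2 * h + 1 then ?z 1 else if j \<le> h + 1 then 1 else ?z (j - h)) * fst (P j),
       (if j = 2 * h + 1 then ?z 1 else if j \<le> h + 1 then 1 else ?z (j - h)) * snd (P j)) \<and>
       (if j = 2 * h + 1 then ?z 1 else if j \<le> h + 1 then 1 else ?z (j - h)) \<noteq> 0"
    proof cases
      case 1
      then show ?thesis using h2 pts_1(1)[OF h1, of ?z] by (simp add: P_def)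
    next
      case 2
      then show ?thesis using h2 pts_base[of j h ?z] config_eq_\<zeta>[of j] by (simp add: P_def)
    next
      case 3
      then show ?thesis using h2 pts_shift[OF h1, of 1 ?z] pts_1(1)[OF h1, of ?z] \<zeta>_zero
        by (simp add: P_def inv_pt_def)
    next
      case 4
      then show ?thesis
        using h2 pts_shift[OF h1, of "j - h" ?z] pts_base[of "j - h" h ?z] config_eq_\<zeta>[of "j - h"]
          \<zeta>_bar[of "j - h"] config_1 \<zeta>_ne[of "j - h" "h + 1"] \<zeta>_zero
        by (simp add: P_def inv_pt_def)
    next
      case 5
      then show ?thesis using h2 pts_close[OF h1, of 1 ?z] pts_1(1)[OF h1, of ?z] z
        by (simp add: P_def)
    qed
  qed
  also have "\<dots> = V m l"
  proof (cases "m = 1")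
    case True
    then have l: "3 \<le> l" "l < 2 * h" using assms by (auto simp: nonadj_def)
    then have "cross_ratio P m l = (\<zeta> 2 - \<zeta> l) / (\<zeta> 2 - \<zeta> (l + 1))"
      using True by (simp add: cross_ratio_def P_def br_def numeral_2_eq_2)
    also have "\<dots> = c l / c (l + 1)"
      using \<zeta>_diff[of 2 l] \<zeta>_diff[of 2 "l+1"] l by (simp add: F_def)
    also have "\<dots> = V m l"
      using Q_split[of l "l+1"] Q_nonzero[of l] Q_nonzero[of "h+1"] Q_nonzero[of "l+1"] l True h2
      by (simp add: c_def)
    finally show ?thesis .
  next
    case False
    then have m: "2 \<le> m" "m + 2 \<le> l" "l \<le> 2 * h" using assms by (auto simp: nonadj_def)
    have "cross_ratio P m l = F m (l + 1) * F (m + 1) l / (F m l * F (m + 1) (l + 1))"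
    \<comment> \<open>Here \<open>l + 1\<close> is the closing point at infinity, and
      \<open>F m (2 * h + 1)\<close> is an empty product.\<close>
    proof (cases "l = 2 * h")
      case True
      then have "cross_ratio P m l = (\<zeta> (m + 1) - \<zeta> l) / (\<zeta> m - \<zeta> l)"
        using m minus_divide_divide[of "\<zeta> l - \<zeta> (m + 1)" "\<zeta> l - \<zeta> m"]
        by (simp add: cross_ratio_def P_def br_def)
      then show ?thesis using \<zeta>_diff[of m l] \<zeta>_diff[of "m+1" l] m True c_nonzero[of l]
        by (simp add: F_def)
    next
      case False
      then have "cross_ratio P m l =
          (\<zeta> m - \<zeta> (l+1)) * (\<zeta> (m + 1) - \<zeta> l) / ((\<zeta> m - \<zeta> l) * (\<zeta> (m + 1) - \<zeta> (l+1)))"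
        using m by (simp add: cross_ratio_def P_def br_def)
      then show ?thesis
        using \<zeta>_diff[of m l] \<zeta>_diff[of "m+1" l] \<zeta>_diff[of m "l+1"] \<zeta>_diff[of "m+1" "l+1"] m False
          c_nonzero[of l] c_nonzero[of "l+1"]
        by simp
    qed
    then show ?thesis using V_F[OF m] by simp
  qed
  finally show ?thesis ..
qed

end

text \<open>The products telescope for cross ratios of \<open>pts\<close>, and at the points
  \<open>1\<close>, \<open>0\<close>, infinity and \<open>a\<close> they evaluate to the
  coordinates.\<close>

lemma config_of_u_cross_ratio:
  assumes z: "z \<in> sym_configs h" and h: "h \<ge> 2"
    and V: "\<And>i j. nonadj (2 * h) i j \<Longrightarrow> V i j = cross_ratio (pts h z) i j"
  shows "config_of_u h V = z"
proof
  fix j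
  have a: "z 1 \<noteq> 0" "z 2 = 1" "z 1 \<noteq> 1" using z h by (force simp: sym_configs_def)+
  have h1: "h \<ge> 1" using h by simp
  have p: "pts h z 2 = (1, 1)" "pts h z (h + 1) = (0, 1)" "pts h z (h + 2) = (z 1, 1)"
    "pts h z (2 * h + 1) = (z 1, 0)" "pts h z 1 = (1, 0)"
    using h a pts_base[of 2 h z] pts_shift[OF h1, of 1 z] pts_shift[OF h1, of 2 z] pts_close[OF h1, of 1 z]
      pts_1(1)[OF h1, of z] by (auto simp: inv_pt_def add.commute)
  have V': "sprod V A B = sprod (cross_ratio (pts h z)) A B"
    if "\<And>i j. i \<in> A \<Longrightarrow> j \<in> B \<Longrightarrow> nonadj (2 * h) i j" for A B
    unfolding sprod_def using that V by (intro prod.cong refl) auto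
  have nz: "br (pts h z s) (pts h z t) \<noteq> 0" if "2 \<le> s" "s < t" "t \<le> 2 * h + 1" for s t
  proof (cases "t = 2 * h + 1")
    case True
    then show ?thesis using br_pts_nonzero[OF z, of 1 s] p that a by (auto simp: br_def)
  next
    case False
    then show ?thesis using br_pts_nonzero[OF z, of s t] that by simp
  qed
  consider "j = 1" | "2 \<le> j" "j \<le> h" | "j \<notin> {1..h}" by fastforce
  then show "config_of_u h V j = z j"
  proof cases
    case 1
    have "sprod V {2..<h+1} {h+2..<2*h+1} = sprod (cross_ratio (pts h z)) {2..<h+1} {h+2..<2*h+1}"
      by (rule V') (auto simp: nonadj_def)
    also have "\<dots> = br (pts h z 2) (pts h z (2*h+1)) * br (pts h z (h+1)) (pts h z (h+2)) /
        (br (pts h z 2) (pts h z (h+2)) * br (pts h z (h+1)) (pts h z (2*h+1)))"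
      using h by (intro sprod_cross_ratio nz) auto
    also have "\<dots> = - z 1 / (1 - z 1)" using a unfolding p by (simp add: br_def)
    finally have "sprod V {2..<h+1} {h+2..<2*h+1} = - z 1 / (1 - z 1)" .
    moreover have "nonadj (2 * h) 1 (h + 1)" using h by (auto simp: nonadj_def)
    then have "V 1 (h + 1) = cross_ratio (pts h z) 1 (h + 1)" by (rule V)
    then have "V 1 (h + 1) = 1 / (1 - z 1)"
      using p by (simp add: cross_ratio_def br_def numeral_2_eq_2)
    ultimately show ?thesis using 1 a by (simp add: config_of_u_def)
  next
    case 2
    have "sprod V {2..<j} {h+1..<2*h+1} = sprod (cross_ratio (pts h z)) {2..<j} {h+1..<2*h+1}"
      by (rule V') (use 2 in \<open>auto simp: nonadj_def\<close>)
    also have "\<dots> = br (pts h z 2) (pts h z (2*h+1)) * br (pts h z j) (pts h z (h+1)) /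
        (br (pts h z 2) (pts h z (h+1)) * br (pts h z j) (pts h z (2*h+1)))"
      using 2 by (intro sprod_cross_ratio nz) auto
    also have "\<dots> = z j" using a pts_base[of j h z] 2 unfolding p by (simp add: br_def)
    finally show ?thesis using 2 by (simp add: config_of_u_def)
  next
    case 3
    then show ?thesis using z h by (auto simp: config_of_u_def sym_configs_def)
  qed
qed

section \<open>The configuration space as a space of symmetric configurations\<close>

definition antipode :: "nat \<Rightarrow> nat \<Rightarrow> nat"
  where "antipode h i = (if i \<le> h then i + h else i - h)"

text \<open>A uniform description of the three kinds of elements of \<open>\<Pi>\<close>.\<close>

definition cls :: "nat \<Rightarrow> nat \<Rightarrow> nat \<Rightarrow> nat set set"
  where "cls h i j = {{i, j}, {antipode h i, antipode h j}}"

lemma cls_commute: "cls h i j = cls h j i"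
  by (simp add: cls_def insert_commute)

lemma cls_antipode:
  assumes "1 \<le> i" "i \<le> 2 * h" "1 \<le> j" "j \<le> 2 * h"
  shows "cls h (antipode h i) (antipode h j) = cls h i j"
proof -
  have "antipode h (antipode h k) = k" if "1 \<le> k" "k \<le> 2 * h" for k
    using that by (auto simp: antipode_def)
  then show ?thesis using assms by (simp add: cls_def insert_commute)
qed

lemma diag_classes_eq:
  assumes "n \<ge> 1"
  shows "diag_classes n = {cls (n + 1) i j | i j. nonadj (2 * (n + 1)) i j}"
proof (intro equalityI subsetI)
  let ?h = "n + 1"
  fix \<gamma> assume "\<gamma> \<in> diag_classes n"
  then consider (long) i where "\<gamma> = long_diag n i" "1 \<le> i" "i \<le> n + 1"
    | (plain) i j where "\<gamma> = plain_diag n i j" "1 \<le> i" "i < j - 1" "j - 1 < n + 1"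
    | (mix) i j where "\<gamma> = mixed_diag n i j" "1 \<le> i" "i < j" "j \<le> n + 1" "(i, j) \<noteq> (1, n + 1)"
    unfolding diag_classes_def by blast
  then have "\<exists>i j. \<gamma> = cls ?h i j \<and> nonadj (2 * ?h) i j"
  proof cases
    case long
    then show ?thesis using assms
      by (intro exI[of _ i] exI[of _ "i + ?h"])
        (auto simp: long_diag_def cls_def antipode_def bar_def nonadj_def insert_commute)
  next
    case plain
    then show ?thesis
      by (intro exI[of _ i] exI[of _ j])
        (auto simp: plain_diag_def cls_def antipode_def bar_def nonadj_def)
  next
    case mix
    then show ?thesis
      by (intro exI[of _ i] exI[of _ "j + ?h"])
        (auto simp: mixed_diag_def cls_def antipode_def bar_def nonadj_def insert_commute)
  qed
  then show "\<gamma> \<in> {cls ?h i j | i j. nonadj (2 * ?h) i j}" by blast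
next
  let ?h = "n + 1"
  fix \<gamma> assume "\<gamma> \<in> {cls ?h i j | i j. nonadj (2 * ?h) i j}"
  then obtain i j where ij: "\<gamma> = cls ?h i j" "1 \<le> i" "i + 2 \<le> j" "j \<le> 2 * ?h" "(i, j) \<noteq> (1, 2 * ?h)"
    by (auto simp: nonadj_def)
  have long: "long_diag n k \<in> diag_classes n" if "1 \<le> k" "k \<le> n + 1" for k
    using that unfolding diag_classes_def by blast
  have plain: "plain_diag n k l \<in> diag_classes n" if "1 \<le> k" "k < l - 1" "l - 1 < n + 1" for k l
    using that unfolding diag_classes_def by blast
  have mix: "mixed_diag n k l \<in> diag_classes n"
    if "1 \<le> k" "k < l" "l \<le> n + 1" "(k, l) \<noteq> (1, n + 1)" for k l
    using that unfolding diag_classes_def by blast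
  define i' j' where "i' = i - ?h" and "j' = j - ?h"
  \<comment> \<open>Both ends in the first half, a long diagonal, the two orders of a mixed pair,
    both ends in the second half. The excluded pair \<open>(1, n + 1)\<close> is the side
    \<open>{1, 2h}\<close> in the third case and the side \<open>{h, h + 1}\<close> in the
    fourth.\<close>
  consider "j \<le> ?h" | "i \<le> ?h" "j = j' + ?h" "j' = i" | "i \<le> ?h" "j = j' + ?h" "i < j'"
    | "i \<le> ?h" "j = j' + ?h" "1 \<le> j'" "j' < i" | "i = i' + ?h" "j = j' + ?h" "1 \<le> i'"
    using ij unfolding i'_def j'_def by linarith
  then show "\<gamma> \<in> diag_classes n"
  proof cases
    case 1
    then have "\<gamma> = plain_diag n i j"
      using ij by (simp add: cls_def antipode_def plain_diag_def bar_def)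
    then show ?thesis using plain[of i j] ij 1 by simp
  next
    case 2
    then have "\<gamma> = long_diag n i"
      using ij by (simp add: cls_def antipode_def long_diag_def bar_def doubleton_eq_iff)
    then show ?thesis using long[of i] ij 2 by simp
  next
    case 3
    then have "\<gamma> = mixed_diag n i j'"
      using ij by (simp add: cls_def antipode_def mixed_diag_def bar_def doubleton_eq_iff)
    then show ?thesis using mix[of i j'] ij 3 by auto
  next
    case 4
    then have "\<gamma> = mixed_diag n j' i"
      using ij by (simp add: cls_def antipode_def mixed_diag_def bar_def doubleton_eq_iff)
    then show ?thesis using mix[of j' i] ij 4 by auto
  next
    case 5
    then have "\<gamma> = plain_diag n i' j'"
      using ij by (simp add: cls_def antipode_def plain_diag_def bar_def doubleton_eq_iff)
    then show ?thesis using plain[of i' j'] ij 5 by simp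
  qed
qed

lemma cls_in: "n \<ge> 1 \<Longrightarrow> nonadj (2 * (n + 1)) i j \<Longrightarrow> cls (n + 1) i j \<in> diag_classes n"
  using diag_classes_eq by blast

lemma diag_classes_member:
  assumes "n \<ge> 1" "\<omega> \<in> diag_classes n" "d \<in> \<omega>"
  obtains k l where "d = {k, l}" "\<omega> = cls (n + 1) k l" "1 \<le> k" "k < l" "l \<le> 2 * (n + 1)"
proof -
  let ?h = "n + 1"
  obtain i j where \<omega>: "\<omega> = cls ?h i j" and ij: "1 \<le> i" "i < j" "j \<le> 2 * ?h"
    using assms diag_classes_eq[of n] by (auto simp: nonadj_def)
  let ?i = "antipode ?h i" and ?j = "antipode ?h j"
  have r: "1 \<le> ?i" "1 \<le> ?j" "?i \<le> 2 * ?h" "?j \<le> 2 * ?h" "?i \<noteq> ?j"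
    using ij by (auto simp: antipode_def)
  have \<omega>': "\<omega> = cls ?h ?i ?j" unfolding \<omega> using cls_antipode[of i ?h j] ij by simp
  from assms(3) consider "d = {i, j}" | "d = {?i, ?j}" unfolding \<omega> cls_def by blast
  then show thesis
  proof cases
    case 1
    then show thesis using that \<omega> ij by blast
  next
    case 2
    show thesis
    proof (cases "?i < ?j")
      case True
      then show thesis using that[OF 2 \<omega>'] r by blast
    next
      case False
      then show thesis using that[of ?j ?i] 2 \<omega>' r cls_commute[of ?h ?i ?j] by (simp add: insert_commute)
    qed
  qed
qed

text \<open>The exponent counts the diagonals of a class that cross \<open>{i, j}\<close>, so the
  product runs over all crossing diagonals, each once. Those are the pairs with one end strictly
  between \<open>i\<close> and \<open>j\<close> and the other end outside.\<close>

lemma prod_compat_degree: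
  fixes u :: "nat set set \<Rightarrow> 'a::field"
  assumes n: "n \<ge> 1" and ij: "nonadj (2 * (n + 1)) i j"
  shows "(\<Prod>\<omega>\<in>diag_classes n. u \<omega> ^ compat_degree \<omega> (cls (n + 1) i j)) =
    sprod (\<lambda>k l. u (cls (n + 1) k l)) {i<..<j} ({j<..2 * (n + 1)} \<union> {1..<i})"
proof -
  let ?h = "n + 1" let ?e = "{i, j}"
  let ?A = "{i<..<j}" let ?B = "{j<..2 * (n + 1)} \<union> {1..<i}"
  let ?S = "Sigma (diag_classes n) (\<lambda>\<omega>. {d \<in> \<omega>. crosses d ?e})"
  let ?f = "\<lambda>(k, l). (cls ?h k l, {k, l})"
  have i: "1 \<le> i" "i + 2 \<le> j" "j \<le> 2 * ?h" using ij by (auto simp: nonadj_def)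
  have fin: "finite \<omega>" if "\<omega> \<in> diag_classes n" for \<omega>
    using that diag_classes_eq[OF n] by (auto simp: cls_def)
  have "(\<Prod>\<omega>\<in>diag_classes n. u \<omega> ^ compat_degree \<omega> (cls ?h i j)) =
      (\<Prod>\<omega>\<in>diag_classes n. \<Prod>d\<in>{d \<in> \<omega>. crosses d ?e}. u \<omega>)"
    using compat_degree_eq[OF _ cls_in[OF n ij], of _ ?e] by (intro prod.cong refl) (simp add: cls_def)
  also have "\<dots> = (\<Prod>(\<omega>, d)\<in>?S. u \<omega>)"
    by (rule prod.Sigma) (use finite_diag_classes fin in auto)
  also have "\<dots> = (\<Prod>(k, l)\<in>?A \<times> ?B. u (cls ?h k l))"
  proof (rule prod.reindex_cong[of ?f])
    show "inj_on ?f (?A \<times> ?B)" by (auto simp: inj_on_def doubleton_eq_iff)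
    show "?S = ?f ` (?A \<times> ?B)"
    proof (intro equalityI subsetI)
      fix x assume "x \<in> ?S"
      then obtain \<omega> d where x: "x = (\<omega>, d)" "\<omega> \<in> diag_classes n" "d \<in> \<omega>" "crosses d ?e" by auto
      obtain k l where kl: "d = {k, l}" "\<omega> = cls ?h k l" "1 \<le> k" "k < l" "l \<le> 2 * ?h"
        using diag_classes_member[OF n x(2,3)] .
      have "k < i \<and> i < l \<and> l < j \<or> i < k \<and> k < j \<and> j < l"
        using x(4) kl i by (simp add: crosses_pair)
      then show "x \<in> ?f ` (?A \<times> ?B)"
      proof
        assume "k < i \<and> i < l \<and> l < j"
        then have "(l, k) \<in> ?A \<times> ?B" "x = ?f (l, k)"
          using x kl cls_commute[of ?h k l] by (auto simp: insert_commute)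
        then show ?thesis by blast
      next
        assume "i < k \<and> k < j \<and> j < l"
        then have "(k, l) \<in> ?A \<times> ?B" "x = ?f (k, l)" using x kl by auto
        then show ?thesis by blast
      qed
    next
      fix x assume "x \<in> ?f ` (?A \<times> ?B)"
      then obtain k l where kl: "x = (cls ?h k l, {k, l})" "k \<in> ?A" "l \<in> ?B" by auto
      have "nonadj (2 * ?h) k l \<or> nonadj (2 * ?h) l k" using kl i by (auto simp: nonadj_def)
      then have "cls ?h k l \<in> diag_classes n" using cls_in[OF n] cls_commute by metis
      moreover have "crosses {k, l} ?e"
      proof (cases "k < l")
        case True
        then show ?thesis using kl i by (auto simp: crosses_pair)
      next
        case False
        then have "l < k" using kl by auto
        then show ?thesis using kl i crosses_pair[of l k i j] by (auto simp: insert_commute)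
      qed
      ultimately show "x \<in> ?S" using kl by (auto simp: cls_def)
    qed
  qed auto
  also have "\<dots> = sprod (\<lambda>k l. u (cls ?h k l)) ?A ?B"
    unfolding sprod_def by (rule prod.cartesian_product[symmetric])
  finally show ?thesis .
qed

lemma config_space_eq:
  assumes "n \<ge> 1"
  shows "config_space n = {u :: nat set set \<Rightarrow> 'a::field. u \<in> diag_classes n \<rightarrow>\<^sub>E UNIV - {0} \<and>
    (\<forall>i j. nonadj (2 * (n + 1)) i j \<longrightarrow> u (cls (n + 1) i j) +
      sprod (\<lambda>k l. u (cls (n + 1) k l)) {i<..<j} ({j<..2 * (n + 1)} \<union> {1..<i}) = 1)}"
proof -
  have "(\<forall>\<gamma>\<in>diag_classes n. u \<gamma> + (\<Prod>\<omega>\<in>diag_classes n. u \<omega> ^ compat_degree \<omega> \<gamma>) = 1) \<longleftrightarrow>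
    (\<forall>i j. nonadj (2 * (n + 1)) i j \<longrightarrow> u (cls (n + 1) i j) +
      sprod (\<lambda>k l. u (cls (n + 1) k l)) {i<..<j} ({j<..2 * (n + 1)} \<union> {1..<i}) = 1)"
    for u :: "nat set set \<Rightarrow> 'a"
  proof -
    have *: "(\<forall>\<gamma>\<in>diag_classes n. R \<gamma>) \<longleftrightarrow> (\<forall>i j. nonadj (2 * (n + 1)) i j \<longrightarrow> R (cls (n + 1) i j))" for R
      unfolding diag_classes_eq[OF assms] by blast
    have "(u (cls (n + 1) i j) + (\<Prod>\<omega>\<in>diag_classes n. u \<omega> ^ compat_degree \<omega> (cls (n + 1) i j)) = 1) \<longleftrightarrow>
      (u (cls (n + 1) i j) + sprod (\<lambda>k l. u (cls (n + 1) k l)) {i<..<j} ({j<..2 * (n + 1)} \<union> {1..<i}) = 1)"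
      if "nonadj (2 * (n + 1)) i j" for i j
      by (simp only: prod_compat_degree[OF assms that])
    then show ?thesis unfolding * by blast
  qed
  then show ?thesis unfolding config_space_def by auto
qed

lemma sym_u_solution_config:
  assumes "n \<ge> 1" "u \<in> config_space n"
  shows "sym_u_solution (\<lambda>i j. u (cls (n + 1) i j)) (n + 1)"
proof
  show "u (cls (n + 1) i j) = u (cls (n + 1) j i)" for i j by (simp add: cls_commute)
  show "u (cls (n + 1) i j) \<noteq> 0" if "nonadj (2 * (n + 1)) i j" for i j
    using cls_in[OF assms(1) that] assms(2) by (auto simp: config_space_def)
  show "u (cls (n + 1) i j) + sprod (\<lambda>i j. u (cls (n + 1) i j)) {i<..<j} ({j<..2 * (n + 1)} \<union> {1..<i}) = 1"
    if "nonadj (2 * (n + 1)) i j" for i j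
    using assms(2) that unfolding config_space_eq[OF assms(1)] by blast
  show "2 \<le> n + 1" using assms(1) by simp
  show "u (cls (n + 1) i (j + (n + 1))) = u (cls (n + 1) (i + (n + 1)) j)"
    if "1 \<le> i" "i \<le> n + 1" "1 \<le> j" "j \<le> n + 1" for i j
    using that by (simp add: cls_def antipode_def insert_commute)
qed

section \<open>The correspondence between configurations and u-coordinates\<close>

lemma cross_ratio_pts_antipode:
  assumes "1 \<le> i" "i \<le> 2 * h" "1 \<le> j" "j \<le> 2 * h" "z 1 \<noteq> 0" "i < j"
  shows "cross_ratio (pts h z) (antipode h i) (antipode h j) = cross_ratio (pts h z) i j"
proof -
  have h: "h \<ge> 1" using assms by simp
  consider "j \<le> h" | "i \<le> h" "h < j" | "h < i" by linarith
  then show ?thesis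
  proof cases
    case 1
    then show ?thesis using cross_ratio_pts_shift[of h i j z] assms h by (simp add: antipode_def)
  next
    case 2
    \<comment> \<open>The antipode of \<open>j\<close> is \<open>j - h\<close>, while the shift
      leads to \<open>j + h\<close>; the full turn \<open>2 * h\<close> closes the gap.\<close>
    then have "cross_ratio (pts h z) (i + h) (j - h) = cross_ratio (pts h z) (i + h) (j - h + 2 * h)"
      using cross_ratio_pts_close[of h "i + h" "j - h" z] assms h by simp
    also have "j - h + 2 * h = j + h" using 2 by simp
    finally show ?thesis using cross_ratio_pts_shift[of h i j z] assms h 2 by (simp add: antipode_def)
  next
    case 3
    then show ?thesis using cross_ratio_pts_shift[of h "i - h" "j - h" z] assms h by (simp add: antipode_def)
  qed
qed

text \<open>A class may be given by several index pairs; one is chosen, and half-turn invariance of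
  the cross ratio makes the value independent of the choice. The restriction to
  \<open>diag_classes n\<close> yields the extensional functions required by
  \<open>config_space\<close>.\<close>

definition u_of_config :: "nat \<Rightarrow> (nat \<Rightarrow> 'a::field) \<Rightarrow> nat set set \<Rightarrow> 'a"
  where "u_of_config n z = (\<lambda>\<gamma>\<in>diag_classes n.
    let p = (SOME p. nonadj (2 * (n + 1)) (fst p) (snd p) \<and> cls (n + 1) (fst p) (snd p) = \<gamma>)
    in cross_ratio (pts (n + 1) z) (fst p) (snd p))"

lemma u_of_config_cls:
  assumes n: "n \<ge> 1" and z: "z 1 \<noteq> 0" and ij: "nonadj (2 * (n + 1)) i j"
  shows "u_of_config n z (cls (n + 1) i j) = cross_ratio (pts (n + 1) z) i j"
proof -
  let ?h = "n + 1"
  define p where "p = (SOME p. nonadj (2 * ?h) (fst p) (snd p) \<and> cls ?h (fst p) (snd p) = cls ?h i j)"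
  have p: "nonadj (2 * ?h) (fst p) (snd p) \<and> cls ?h (fst p) (snd p) = cls ?h i j"
    unfolding p_def by (rule someI[of _ "(i, j)"]) (use ij in auto)
  have "{fst p, snd p} \<in> cls ?h (fst p) (snd p)" by (simp add: cls_def)
  then have "{fst p, snd p} \<in> cls ?h i j" by (simp only: p)
  then have "{fst p, snd p} = {i, j} \<or> {fst p, snd p} = {antipode ?h i, antipode ?h j}"
    by (simp only: cls_def insert_iff empty_iff simp_thms)
  then have "fst p = i \<and> snd p = j \<or> fst p = j \<and> snd p = i \<or>
      fst p = antipode ?h i \<and> snd p = antipode ?h j \<or> fst p = antipode ?h j \<and> snd p = antipode ?h i"
    by (simp only: doubleton_eq_iff disj_assoc)
  moreover have "cross_ratio (pts ?h z) (antipode ?h i) (antipode ?h j) = cross_ratio (pts ?h z) i j"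
    using cross_ratio_pts_antipode[of i ?h j z] ij z by (simp add: nonadj_def)
  ultimately have "cross_ratio (pts ?h z) (fst p) (snd p) = cross_ratio (pts ?h z) i j"
    using cross_ratio_commute[of "pts ?h z" j i] cross_ratio_commute[of "pts ?h z" "antipode ?h j" "antipode ?h i"]
    by (elim disjE conjE) (simp_all only:)
  then show ?thesis using cls_in[OF n ij] by (simp add: u_of_config_def p_def)
qed

lemma u_of_config_in:
  assumes n: "n \<ge> 1" and z: "z \<in> sym_configs (n + 1)"
  shows "u_of_config n z \<in> config_space n"
proof -
  let ?h = "n + 1"
  let ?u = "u_of_config n z"
  interpret u_solution "cross_ratio (pts ?h z)" "2 * ?h"
    using u_solution_pts[OF z] by simp
  have "z 1 \<noteq> 0" using z by (simp add: sym_configs_def)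
  note u = u_of_config_cls[of n z, OF n this]
  have "?u (cls ?h i j) + sprod (\<lambda>k l. ?u (cls ?h k l)) {i<..<j} ({j<..2 * ?h} \<union> {1..<i}) = 1"
    if ij: "nonadj (2 * ?h) i j" for i j
  proof -
    have "?u (cls ?h k l) = cross_ratio (pts ?h z) k l"
      if "k \<in> {i<..<j}" "l \<in> {j<..2 * ?h} \<union> {1..<i}" for k l
    proof -
      have "nonadj (2 * ?h) k l \<or> nonadj (2 * ?h) l k" using that ij by (auto simp: nonadj_def)
      then show ?thesis using u cls_commute[of ?h k l] cross_ratio_commute by metis
    qed
    then have "sprod (\<lambda>k l. ?u (cls ?h k l)) {i<..<j} ({j<..2 * ?h} \<union> {1..<i}) =
        sprod (cross_ratio (pts ?h z)) {i<..<j} ({j<..2 * ?h} \<union> {1..<i})"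
      unfolding sprod_def by (intro prod.cong refl)
    then show ?thesis using u_eq[OF ij] u[OF ij] by simp
  qed
  moreover have "?u \<in> diag_classes n \<rightarrow>\<^sub>E UNIV - {0}"
  proof (rule PiE_I)
    fix \<gamma> assume "\<gamma> \<in> diag_classes n"
    then obtain i j where "\<gamma> = cls ?h i j" "nonadj (2 * ?h) i j" using diag_classes_eq[OF n] by blast
    then show "?u \<gamma> \<in> UNIV - {0}" using u nonzero by simp
  qed (simp add: u_of_config_def)
  ultimately show ?thesis unfolding config_space_eq[OF n] by blast
qed

abbreviation config_of :: "nat \<Rightarrow> (nat set set \<Rightarrow> 'a::field) \<Rightarrow> nat \<Rightarrow> 'a"
  where "config_of n u \<equiv> config_of_u (n + 1) (\<lambda>i j. u (cls (n + 1) i j))"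

lemma config_of_in: "n \<ge> 1 \<Longrightarrow> u \<in> config_space n \<Longrightarrow> config_of n u \<in> sym_configs (n + 1)"
  by (rule sym_u_solution.config_in[OF sym_u_solution_config])

lemma config_of_u_of_config:
  assumes "n \<ge> 1" "z \<in> sym_configs (n + 1)"
  shows "config_of n (u_of_config n z) = z"
proof (rule config_of_u_cross_ratio[OF assms(2)])
  have "z 1 \<noteq> 0" using assms(2) by (simp add: sym_configs_def)
  then show "u_of_config n z (cls (n + 1) i j) = cross_ratio (pts (n + 1) z) i j"
    if "nonadj (2 * (n + 1)) i j" for i j
    using u_of_config_cls[OF assms(1) _ that] by blast
qed (use assms in simp)

lemma u_of_config_config_of:
  assumes n: "n \<ge> 1" and u: "u \<in> config_space n"
  shows "u_of_config n (config_of n u) = u"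
proof (rule PiE_ext)
  interpret sym_u_solution "\<lambda>i j. u (cls (n + 1) i j)" "n + 1"
    by (rule sym_u_solution_config[OF assms])
  have "config_of n u 1 \<noteq> 0" using config_in by (simp add: sym_configs_def)
  note v = u_of_config_cls[of n "config_of n u", OF n this]
  show "u_of_config n (config_of n u) \<in> diag_classes n \<rightarrow>\<^sub>E UNIV - {0}"
    using u_of_config_in[OF n config_in] by (simp add: config_space_def)
  show "u \<in> diag_classes n \<rightarrow>\<^sub>E UNIV - {0}" using u by (simp add: config_space_def)
  fix \<gamma> assume "\<gamma> \<in> diag_classes n"
  then obtain i j where "\<gamma> = cls (n + 1) i j" "nonadj (2 * (n + 1)) i j" using diag_classes_eq[OF n] by blast
  then show "u_of_config n (config_of n u) \<gamma> = u \<gamma>" using v V_eq_cross_ratio by simp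
qed

lemma bij_betw_u_of_config:
  "n \<ge> 1 \<Longrightarrow> bij_betw (u_of_config n) (sym_configs (n + 1)) (config_space n)"
  by (rule bij_betw_byWitness[of _ "config_of n"])
    (use config_of_u_of_config u_of_config_config_of u_of_config_in config_of_in in blast)+

section \<open>Counting symmetric configurations\<close>

text \<open>
  The values forbidden for a further coordinate, indexed by \<open>{-k..k}\<close>; the indices \<open>1\<close> and \<open>-1\<close>
  stand for the square roots \<open>r\<close> and \<open>-r\<close> of \<open>z 1\<close> and are dropped if there are none.
\<close>

definition removed_pt :: "'a::field \<Rightarrow> (nat \<Rightarrow> 'a) \<Rightarrow> int \<Rightarrow> 'a"
  where "removed_pt r z j = (if j = 0 then 0 else if j = 1 then r else if j = -1 then - r
    else if j > 0 then z (nat j) else z 1 / z (nat (- j)))"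

definition removed_idx :: "nat \<Rightarrow> bool \<Rightarrow> int set"
  where "removed_idx k sq = {- int k..int k} - (if sq then {} else {1, -1})"

lemma card_removed_idx:
  assumes "k \<ge> 2"
  shows "card (removed_idx k sq) = (if sq then 2 * k + 1 else 2 * k - 1)"
proof (cases sq)
  case False
  have "card ({- int k..int k} - {1, -1}) = card {- int k..int k} - card {1, -1 :: int}"
    by (rule card_Diff_subset) (use assms in auto)
  then show ?thesis using False assms by (simp add: removed_idx_def)
qed (simp add: removed_idx_def)

lemma removed_idx_cases:
  assumes "j \<in> removed_idx k sq"
  obtains "j = 0" | "j = 1" | "j = -1" | i where "2 \<le> i" "i \<le> k" "j = int i"
    | i where "2 \<le> i" "i \<le> k" "j = - int i"
proof -
  have j: "- int k \<le> j" "j \<le> int k" using assms by (auto simp: removed_idx_def)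
  consider "j = 0" | "j = 1" | "j = -1" | "2 \<le> j" | "j \<le> -2" by linarith
  then show thesis
  proof cases
    case 4
    then show thesis using that(4)[of "nat j"] j by simp
  next
    case 5
    then show thesis using that(5)[of "nat (- j)"] j by simp
  qed (use that in auto)
qed

lemma removed_pt_cases:
  assumes "j \<in> removed_idx k sq" "sq \<Longrightarrow> r * r = z 1"
  obtains "j = 0" "removed_pt r z j = 0"
  | "j = 1" "removed_pt r z j = r" "r * r = z 1"
  | "j = -1" "removed_pt r z j = - r" "r * r = z 1"
  | i where "2 \<le> i" "i \<le> k" "j = int i" "removed_pt r z j = z i"
  | i where "2 \<le> i" "i \<le> k" "j = - int i" "removed_pt r z j = z 1 / z i"
proof -
  have "sq" if "j = 1 \<or> j = -1" using that assms(1) by (auto simp: removed_idx_def split: if_splits)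
  then show thesis
    using removed_idx_cases[OF assms(1)] that assms(2) unfolding removed_pt_def
    by (smt (verit) nat_int of_nat_0_le_iff)
qed

text \<open>The equation \<open>z i * t = z 1\<close> is solved by \<open>z 1 / z i\<close>, and
  \<open>t * t = z 1\<close> by \<open>r\<close> and \<open>- r\<close> or, if \<open>sq\<close>
  fails, by nothing. The conditions on a further coordinate thus become the avoidance of a finite
  list of values.\<close>

lemma removed_pt_image:
  assumes "sq \<Longrightarrow> r * r = z 1" "\<not> sq \<Longrightarrow> \<nexists>s. s * s = z 1" and z: "z \<in> sym_configs k"
  shows "t \<notin> removed_pt r z ` removed_idx k sq \<longleftrightarrow>
    t \<noteq> 0 \<and> t * t \<noteq> z 1 \<and> (\<forall>i\<in>{2..k}. z i \<noteq> t \<and> z i * t \<noteq> z 1)"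
proof
  assume t: "t \<noteq> 0 \<and> t * t \<noteq> z 1 \<and> (\<forall>i\<in>{2..k}. z i \<noteq> t \<and> z i * t \<noteq> z 1)"
  show "t \<notin> removed_pt r z ` removed_idx k sq"
  proof
    assume "t \<in> removed_pt r z ` removed_idx k sq"
    then obtain j where j: "j \<in> removed_idx k sq" "t = removed_pt r z j" by blast
    have inv: "z 1 / z i \<noteq> t" if "2 \<le> i" "i \<le> k" for i
    proof
      have "z i \<noteq> 0" using that z by (simp add: sym_configs_def)
      moreover assume "z 1 / z i = t"
      ultimately have "z i * t = z 1" by (simp add: field_simps)
      then show False using t that by auto
    qed
    show False
      by (rule removed_pt_cases[of j k sq r z, OF j(1) assms(1)]) (use j(2) t inv in auto)
  qed
next
  assume t: "t \<notin> removed_pt r z ` removed_idx k sq"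
  then have ne: "t \<noteq> removed_pt r z j" if "j \<in> removed_idx k sq" for j using that by blast
  have "t \<noteq> 0" using ne[of 0] by (simp add: removed_idx_def removed_pt_def)
  moreover have "t * t \<noteq> z 1"
  proof
    assume tt: "t * t = z 1"
    then have sq using assms(2) by blast
    moreover from this have "t * t = r * r" using tt assms(1) by simp
    then have "t = r \<or> t = - r" by (simp add: square_eq_iff)
    moreover have "k \<ge> 1" using z by (cases k) (auto simp: sym_configs_def)
    ultimately show False using ne[of 1] ne[of "-1"] by (auto simp: removed_idx_def removed_pt_def)
  qed
  moreover have "z i \<noteq> t \<and> z i * t \<noteq> z 1" if "i \<in> {2..k}" for i
  proof -
    have "z i \<noteq> 0" using that z by (simp add: sym_configs_def)
    moreover have "int i \<in> removed_idx k sq" "- int i \<in> removed_idx k sq"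
      using that by (auto simp: removed_idx_def)
    ultimately show ?thesis using ne[of "int i"] ne[of "- int i"] that
      by (auto simp: removed_pt_def field_simps)
  qed
  ultimately show "t \<noteq> 0 \<and> t * t \<noteq> z 1 \<and> (\<forall>i\<in>{2..k}. z i \<noteq> t \<and> z i * t \<noteq> z 1)" by blast
qed

text \<open>Two coinciding values would contradict one of the inequalities of
  \<open>sym_configs\<close>; separating \<open>r\<close> from \<open>- r\<close> takes
  \<open>2 \<noteq> 0\<close>. Distinctness makes the number of forbidden values the same for every
  configuration.\<close>

lemma inj_removed_pt:
  fixes z :: "nat \<Rightarrow> 'a::field"
  assumes sq: "sq \<Longrightarrow> r * r = z 1" and z: "z \<in> sym_configs k" and two: "(2 :: 'a) \<noteq> 0"
  shows "inj_on (removed_pt r z) (removed_idx k sq)"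
proof (rule linorder_inj_onI)
  have a: "z 1 \<noteq> 0" using z by (simp add: sym_configs_def)
  have nz: "z i \<noteq> 0" "z i * z i \<noteq> z 1" if "2 \<le> i" "i \<le> k" for i using that z by (auto simp: sym_configs_def)
  have ne: "z i \<noteq> z j" "z i * z j \<noteq> z 1" if "2 \<le> i" "i < j" "j \<le> k" for i j
    using that z by (auto simp: sym_configs_def)
  have prod: "z i * z j \<noteq> z 1" if "2 \<le> i" "i \<le> k" "2 \<le> j" "j \<le> k" for i j
    using that nz[of i] ne[of i j] ne[of j i] by (cases i j rule: linorder_cases) (auto simp: mult.commute)
  have rr: "r \<noteq> 0" "- r \<noteq> r" if "r * r = z 1"
  proof -
    show "r \<noteq> 0" using that a by auto
    then show "- r \<noteq> r" using two by (metis add.inverse_inverse add_eq_0_iff mult_2 mult_eq_0_iff)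
  qed
  have root: "z i \<noteq> r" "z i \<noteq> - r" "z 1 / z i \<noteq> r" "z 1 / z i \<noteq> - r"
    if "2 \<le> i" "i \<le> k" "r * r = z 1" for i
  proof -
    show "z i \<noteq> r" "z i \<noteq> - r" using nz[of i] that by auto
    show "z 1 / z i \<noteq> r"
    proof
      assume "z 1 / z i = r"
      then have "r * r = r * z i" using nz[of i] that by (simp add: field_simps)
      then show False using \<open>z i \<noteq> r\<close> rr that by simp
    qed
    show "z 1 / z i \<noteq> - r"
    proof
      assume "z 1 / z i = - r"
      then have "r * r = r * - z i" using nz[of i] that by (simp add: field_simps)
      then show False using \<open>z i \<noteq> - r\<close> rr that by (metis minus_minus mult_left_cancel)
    qed
  qed
  have inv: "z 1 / z i \<noteq> 0" "z 1 / z i \<noteq> z j" if "2 \<le> i" "i \<le> k" "2 \<le> j" "j \<le> k" for i j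
    using nz[of i] prod[OF that(3,4,1,2)] that a by (auto simp: field_simps)
  have inv2: "z 1 / z i \<noteq> z 1 / z j" if "2 \<le> i" "i < j" "j \<le> k" for i j
    using nz[of i] nz[of j] ne[OF that] that a by (auto simp: field_simps)
  note facts = a nz(1) ne(1) rr root inv inv2
  show "removed_pt r z i \<noteq> removed_pt r z j" if ij: "i < j" "i \<in> removed_idx k sq" "j \<in> removed_idx k sq" for i j
    by (insert ij(1), rule removed_pt_cases[of i k sq r z, OF ij(2) sq]; rule removed_pt_cases[of j k sq r z, OF ij(3) sq];
      simp add: facts facts[symmetric] del: One_nat_def)
qed (rule linear)

section \<open>The fibration forgetting the last coordinate\<close>

lemma sym_configs_extend:
  assumes "k \<ge> 2" "z \<in> sym_configs k"
  shows "z(Suc k := t) \<in> sym_configs (Suc k) \<longleftrightarrow>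
    t \<noteq> 0 \<and> t * t \<noteq> z 1 \<and> (\<forall>i\<in>{2..k}. z i \<noteq> t \<and> z i * t \<noteq> z 1)"
proof
  assume *: "z(Suc k := t) \<in> sym_configs (Suc k)"
  let ?w = "z(Suc k := t)"
  have "\<forall>j\<in>{2..Suc k}. ?w j \<noteq> 0 \<and> ?w j * ?w j \<noteq> ?w 1" using * unfolding sym_configs_def by blast
  then have "?w (Suc k) \<noteq> 0 \<and> ?w (Suc k) * ?w (Suc k) \<noteq> ?w 1"
    by (rule bspec) (use assms in simp)
  moreover have "?w i \<noteq> ?w (Suc k) \<and> ?w i * ?w (Suc k) \<noteq> ?w 1" if "i \<in> {2..k}" for i
  proof -
    have "\<forall>i j. 2 \<le> i \<longrightarrow> i < j \<longrightarrow> j \<le> Suc k \<longrightarrow> ?w i \<noteq> ?w j \<and> ?w i * ?w j \<noteq> ?w 1"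
      using * unfolding sym_configs_def by blast
    from this[rule_format, of i "Suc k"] show ?thesis using that by fastforce
  qed
  ultimately show "t \<noteq> 0 \<and> t * t \<noteq> z 1 \<and> (\<forall>i\<in>{2..k}. z i \<noteq> t \<and> z i * t \<noteq> z 1)"
    using assms by auto
next
  assume *: "t \<noteq> 0 \<and> t * t \<noteq> z 1 \<and> (\<forall>i\<in>{2..k}. z i \<noteq> t \<and> z i * t \<noteq> z 1)"
  show "z(Suc k := t) \<in> sym_configs (Suc k)"
    using * assms unfolding sym_configs_def by (auto simp: le_Suc_eq)
qed

lemma sym_configs_restrict:
  assumes "k \<ge> 2" "w \<in> sym_configs (Suc k)"
  shows "w(Suc k := 0) \<in> sym_configs k"
proof -
  let ?z = "w(Suc k := 0)"
  have w: "w 2 = 1 \<and> w 1 \<noteq> 0" "\<forall>j\<in>{2..Suc k}. w j \<noteq> 0 \<and> w j * w j \<noteq> w 1"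
    "\<forall>i j. 2 \<le> i \<longrightarrow> i < j \<longrightarrow> j \<le> Suc k \<longrightarrow> w i \<noteq> w j \<and> w i * w j \<noteq> w 1"
    "\<forall>j. j \<notin> {1..Suc k} \<longrightarrow> w j = 0"
    using assms(2) unfolding sym_configs_def by blast+
  have eq: "?z j = w j" if "j \<le> k" for j using that by simp
  have "?z j = 0" if "j \<notin> {1..k}" for j
  proof (cases "j = Suc k")
    case False
    then have "j \<notin> {1..Suc k}" using that by auto
    then show ?thesis using w(4) False by (simp del: One_nat_def)
  qed simp
  moreover have "?z 2 = w 2" "?z 1 = w 1" using eq assms(1) by auto
  ultimately show ?thesis using w(1-3) eq unfolding sym_configs_def by (simp del: fun_upd_apply One_nat_def)
qed

text \<open>The number of forbidden values depends on whether the parameter is a square, so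
  configurations are grouped by sets \<open>A\<close> of parameters of one kind.\<close>

definition configs_over :: "nat \<Rightarrow> 'a set \<Rightarrow> (nat \<Rightarrow> 'a::field) set"
  where "configs_over k A = {z \<in> sym_configs k. z 1 \<in> A}"

lemma configs_over_Suc:
  assumes "k \<ge> 2" "\<And>a. a \<in> A \<Longrightarrow> sq \<Longrightarrow> r a * r a = a" "\<And>a. a \<in> A \<Longrightarrow> \<not> sq \<Longrightarrow> \<nexists>s. s * s = a"
  shows "configs_over (Suc k) A = {z(Suc k := t) | z t. z \<in> configs_over k A \<and>
    t \<notin> removed_pt (r (z 1)) z ` removed_idx k sq}"
proof -
  have img: "t \<notin> removed_pt (r (z 1)) z ` removed_idx k sq \<longleftrightarrow> z(Suc k := t) \<in> sym_configs (Suc k)"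
    if "z \<in> configs_over k A" for z t
    using that removed_pt_image[of sq "r (z 1)" z k t] sym_configs_extend[OF assms(1), of z t] assms(2,3)[of "z 1"]
    unfolding configs_over_def by blast
  show ?thesis
  proof (intro equalityI subsetI)
    fix w assume w: "w \<in> configs_over (Suc k) A"
    let ?z = "w(Suc k := 0)"
    have "?z \<in> configs_over k A" using w sym_configs_restrict[OF assms(1), of w] assms(1)
      by (simp add: configs_over_def)
    moreover have "w = ?z(Suc k := w (Suc k))" by simp
    ultimately show "w \<in> {z(Suc k := t) | z t. z \<in> configs_over k A \<and>
        t \<notin> removed_pt (r (z 1)) z ` removed_idx k sq}"
      using img w by (smt (verit) configs_over_def mem_Collect_eq)
  next
    fix w assume "w \<in> {z(Suc k := t) | z t. z \<in> configs_over k A \<and>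
        t \<notin> removed_pt (r (z 1)) z ` removed_idx k sq}"
    then show "w \<in> configs_over (Suc k) A"
      using img assms(1) by (auto simp: configs_over_def)
  qed
qed

lemma configs_over_2:
  "configs_over 2 A = (\<lambda>a j. if j = 1 then a else if j = 2 then 1 else 0) ` (A - {0, 1 :: 'a::field})"
proof -
  have "z = (\<lambda>j. if j = 1 then z 1 else if j = 2 then 1 else 0)" if "z \<in> sym_configs 2" for z :: "nat \<Rightarrow> 'a"
    using that by (auto simp: sym_configs_def fun_eq_iff)
  moreover have "z 1 \<noteq> 0 \<and> z 1 \<noteq> 1" if "z \<in> sym_configs 2" for z :: "nat \<Rightarrow> 'a"
    using that by (force simp: sym_configs_def)
  moreover have "(\<lambda>j. if j = 1 then a else if j = 2 then 1 else 0) \<in> sym_configs 2" if "a \<noteq> 0" "a \<noteq> 1" for a :: 'a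
    using that by (auto simp: sym_configs_def)
  ultimately show ?thesis unfolding configs_over_def image_def by fastforce
qed

text \<open>Each new coordinate multiplies the count by the number of remaining values. In the
  integers this also holds when a factor is negative: the set of shorter configurations is then
  empty.\<close>

lemma card_configs_over:
  fixes A :: "'a::{field,finite} set"
  assumes "k \<ge> 2" "\<And>a. a \<in> A \<Longrightarrow> sq \<Longrightarrow> r a * r a = a" "\<And>a. a \<in> A \<Longrightarrow> \<not> sq \<Longrightarrow> \<nexists>s. s * s = a"
    and two: "(2 :: 'a) \<noteq> 0"
  shows "finite (configs_over k A) \<and>
    int (card (configs_over k A)) = int (card (A - {0, 1})) * (\<Prod>m=2..<k. int CARD('a) - int (card (removed_idx m sq)))"
  using assms(1)
proof (induction k rule: dec_induct)
  case base
  have "inj_on (\<lambda>a (j :: nat). if j = 1 then a else if j = 2 then 1 else 0 :: 'a) (A - {0, 1})"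
    by (rule inj_onI) (metis (mono_tags))
  then show ?case unfolding configs_over_2 by (simp add: card_image del: One_nat_def)
next
  case (step m)
  let ?R = "\<lambda>z. removed_pt (r (z 1)) z ` removed_idx m sq"
  let ?S = "Sigma (configs_over m A) (\<lambda>z. - ?R z)"
  have "configs_over (Suc m) A = (\<lambda>(z, t). z(Suc m := t)) ` ?S"
    using configs_over_Suc[OF step.hyps(1) assms(2,3)] by auto
  moreover have "inj_on (\<lambda>(z, t). z(Suc m := t)) ?S"
  proof (rule inj_onI, clarsimp)
    fix z t z' t' assume "z \<in> configs_over m A" "z' \<in> configs_over m A" and eq: "z(Suc m := t) = z'(Suc m := t')"
    then have "z (Suc m) = 0" "z' (Suc m) = 0" by (auto simp: configs_over_def sym_configs_def)
    then show "z = z' \<and> t = t'" using eq by (metis fun_upd_same fun_upd_triv fun_upd_upd)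
  qed
  ultimately have "card (configs_over (Suc m) A) = card ?S" "finite (configs_over (Suc m) A) \<longleftrightarrow> finite ?S"
    by (simp_all add: card_image finite_image_iff)
  moreover have "finite ?S" using step.IH by auto
  moreover have "int (card (- ?R z)) = int CARD('a) - int (card (removed_idx m sq))" if "z \<in> configs_over m A" for z
  proof -
    have "card (?R z) = card (removed_idx m sq)"
      using that by (intro card_image inj_removed_pt two) (auto simp: configs_over_def intro: assms(2))
    then show ?thesis using card_mono[of UNIV "?R z"] by (simp add: Compl_eq_Diff_UNIV card_Diff_subset of_nat_diff)
  qed
  then have "int (card ?S) = int (card (configs_over m A)) * (int CARD('a) - int (card (removed_idx m sq)))"
    using step.IH by (simp add: card_SigmaI)
  ultimately show ?case using step by (simp add: mult_ac)
qed

section \<open>The count over a finite field\<close>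

lemma card_squares:
  assumes two: "(2 :: 'a::{field,finite}) \<noteq> 0"
  shows "2 * card ((\<lambda>x :: 'a. x * x) ` (- {0})) = CARD('a) - 1"
proof -
  define f where "f x = x * x" for x :: 'a
  have fib: "card {x. x \<in> - {0} \<and> f x = y} = 2" if y: "y \<in> f ` (- {0})" for y
  proof -
    from y obtain x where y: "y = f x" and "x \<in> - {0}" by (rule imageE)
    then have "x \<noteq> 0" by simp
    then have "x \<noteq> - x" using two by (metis add_eq_0_iff mult_2 mult_eq_0_iff)
    moreover have "{x. x \<in> - {0} \<and> f x = y} = {x, - x}"
      using \<open>x \<noteq> 0\<close> unfolding y f_def square_eq_iff by auto
    ultimately show ?thesis by simp
  qed
  have "card (- {0 :: 'a}) = (\<Sum>y\<in>f ` (- {0}). \<Sum>x | x \<in> - {0} \<and> f x = y. 1)"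
    unfolding card_eq_sum by (rule sum.image_gen) simp
  also have "\<dots> = (\<Sum>y\<in>f ` (- {0}). 2)"
    by (rule sum.cong[OF refl]) (simp only: card_eq_sum[symmetric] fib)
  finally have "card (- {0 :: 'a}) = 2 * card (f ` (- {0}))" by simp
  moreover have "f = (\<lambda>x. x * x)" by (simp add: f_def fun_eq_iff)
  moreover have "card (- {0 :: 'a}) = CARD('a) - 1" by (simp add: Compl_eq_Diff_UNIV card_Diff_subset)
  ultimately show ?thesis by simp
qed

text \<open>The nonzero squares other than 1 are \<open>(q - 3) / 2\<close> parameters with
  \<open>2m + 1\<close> forbidden values at step \<open>m\<close>; the nonsquares are
  \<open>(q - 1) / 2\<close> parameters with \<open>2m - 1\<close>. Multiplication by
  \<open>q - 3\<close> shifts the first product to \<open>?P * (q - 2n - 1)\<close>, so the sum is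
  \<open>?P * ((q - 2n - 1) + (q - 1)) / 2\<close>.\<close>

lemma card_sym_configs:
  assumes two: "(2 :: 'a::{field,finite}) \<noteq> 0" and n: "n \<ge> 1"
  shows "int (card (sym_configs (n + 1) :: (nat \<Rightarrow> 'a) set)) =
    (int CARD('a) - int n - 1) * (\<Prod>k=2..n. int CARD('a) - (2 * int k - 1))"
proof -
  let ?q = "int CARD('a)"
  define Sq where "Sq = (\<lambda>x :: 'a. x * x) ` (- {0})"
  define N where "N = - insert 0 Sq"
  let ?P = "\<Prod>k=2..n. ?q - (2 * int k - 1)"
  define X where "X = (\<Prod>m=2..<n+1. ?q - int (card (removed_idx m True)))"
  have ex: "\<exists>s. s * s = a" if "a \<in> Sq" for a using that by (auto simp: Sq_def)
  have nex: "\<nexists>s. s * s = a" if "a \<in> N" for a using that by (auto simp: Sq_def N_def image_iff)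
  have n2: "n + 1 \<ge> 2" using n by simp
  have cardSq: "finite (configs_over (n + 1) Sq) \<and>
      int (card (configs_over (n + 1) Sq)) = int (card (Sq - {0, 1})) * X"
    unfolding X_def
  proof (rule card_configs_over[OF n2 _ _ two])
    show "(SOME s. s * s = a) * (SOME s. s * s = a) = a" if "a \<in> Sq" for a
      using someI_ex[OF ex[OF that]] .
  qed auto
  have cardN: "finite (configs_over (n + 1) N) \<and> int (card (configs_over (n + 1) N)) =
      int (card (N - {0, 1})) * (\<Prod>m=2..<n+1. ?q - int (card (removed_idx m False)))"
    by (rule card_configs_over[OF n2 _ _ two]) (use nex in auto)
  have one: "1 \<in> Sq" by (auto simp: Sq_def intro: image_eqI[of _ _ 1])
  have zero: "0 \<notin> Sq" by (auto simp: Sq_def)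
  have q: "2 * int (card Sq) = ?q - 1"
    using card_squares[OF two] zero_less_card_finite[where 'a = 'a] unfolding Sq_def by linarith
  have "Sq - {0, 1} = Sq - {1}" using zero by auto
  moreover have "card Sq > 0" using one by (auto simp: card_gt_0_iff)
  ultimately have cSq: "2 * int (card (Sq - {0, 1})) = ?q - 3"
    using q one by (simp add: card_Diff_singleton of_nat_diff)
  have N01: "N - {0, 1} = N" using one by (auto simp: N_def)
  have "card N + card (insert 0 Sq) = CARD('a)"
  proof -
    have "N \<union> insert 0 Sq = UNIV" "N \<inter> insert 0 Sq = {}" by (auto simp: N_def)
    then show ?thesis using card_Un_disjoint[of N "insert 0 Sq"] by simp
  qed
  moreover have "card (insert 0 Sq) = Suc (card Sq)" using zero by simp
  ultimately have cN: "2 * int (card (N - {0, 1})) = ?q - 1"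
    unfolding N01 using q by linarith
  have idx: "int (card (removed_idx m False)) = 2 * int m - 1" "int (card (removed_idx m True)) = 2 * int m + 1"
    if "m \<in> {2..n}" for m
    using that by (simp_all add: card_removed_idx of_nat_diff)
  have ivl: "{2..<n+1} = {2..n}" by auto
  have pN: "(\<Prod>m=2..<n+1. ?q - int (card (removed_idx m False))) = ?P"
    unfolding ivl by (rule prod.cong[OF refl]) (simp only: idx)
  have "X = (\<Prod>m=2..n. ?q - (2 * int m + 1))"
    unfolding X_def ivl by (rule prod.cong[OF refl]) (simp only: idx)
  moreover have "(?q - 3) * (\<Prod>m=2..n. ?q - (2 * int m + 1)) = ?P * (?q - (2 * int n + 1))"
    using n
  proof (induction n rule: dec_induct)
    case (step m)
    have "(?q - 3) * (\<Prod>m=2..Suc m. ?q - (2 * int m + 1)) =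
        ((?q - 3) * (\<Prod>m=2..m. ?q - (2 * int m + 1))) * (?q - (2 * int (Suc m) + 1))"
      using step.hyps by (simp add: prod.nat_ivl_Suc')
    also have "\<dots> = (\<Prod>k=2..Suc m. ?q - (2 * int k - 1)) * (?q - (2 * int (Suc m) + 1))"
      unfolding step.IH using step.hyps by (simp add: prod.nat_ivl_Suc')
    finally show ?case .
  qed simp
  ultimately have pSq: "(?q - 3) * X = ?P * (?q - (2 * int n + 1))" by simp
  have "sym_configs (n + 1) = configs_over (n + 1) Sq \<union> configs_over (n + 1) N"
    by (auto simp: configs_over_def sym_configs_def N_def)
  moreover have "configs_over (n + 1) Sq \<inter> configs_over (n + 1) N = {}"
    by (auto simp: configs_over_def N_def)
  ultimately have "card (sym_configs (n + 1) :: (nat \<Rightarrow> 'a) set) =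
      card (configs_over (n + 1) Sq) + card (configs_over (n + 1) N)"
    using cardSq cardN by (metis card_Un_disjoint)
  then have "2 * int (card (sym_configs (n + 1) :: (nat \<Rightarrow> 'a) set)) =
      2 * int (card (Sq - {0, 1})) * X + 2 * int (card (N - {0, 1})) * ?P"
    using cardSq cardN pN by simp
  also have "\<dots> = ?P * (?q - (2 * int n + 1)) + (?q - 1) * ?P"
    unfolding cSq cN pSq ..
  also have "\<dots> = 2 * ((?q - int n - 1) * ?P)"
  proof -
    have "p * (q - (2 * m + 1)) + (q - 1) * p = 2 * ((q - m - 1) * p)" for p q m :: int
      by (simp add: algebra_simps)
    then show ?thesis .
  qed
  finally show ?thesis by simp
qed

section \<open>Connected components of complements of graphs\<close>

text \<open>A decomposition that can be carried through an induction; by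
  \<open>connected_components_of_pieces\<close> the pieces are the components, so \<open>m\<close>
  is determined by \<open>S\<close>.\<close>

definition has_pieces :: "'a::topological_space set \<Rightarrow> nat \<Rightarrow> bool"
  where "has_pieces S m \<longleftrightarrow> (\<exists>\<F>. finite \<F> \<and> card \<F> = m \<and> disjoint \<F> \<and> \<Union>\<F> = S \<and>
    (\<forall>K\<in>\<F>. K \<noteq> {} \<and> connected K \<and> openin (top_of_set S) K))"

lemma has_piecesI:
  assumes "finite J" "\<And>i. i \<in> J \<Longrightarrow> G i \<noteq> {} \<and> connected (G i) \<and> openin (top_of_set S) (G i)"
    "\<And>i j. i \<in> J \<Longrightarrow> j \<in> J \<Longrightarrow> i \<noteq> j \<Longrightarrow> G i \<inter> G j = {}" "S \<subseteq> \<Union> (G ` J)"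
  shows "has_pieces S (card J)"
  unfolding has_pieces_def
proof (intro exI[of _ "G ` J"] conjI)
  have "inj_on G J" using assms(2,3) by (metis inj_onI inf.idem)
  then show "card (G ` J) = card J" by (rule card_image)
  show "disjoint (G ` J)" unfolding disjoint_def using assms(3) by (metis imageE)
  have "G i \<subseteq> S" if "i \<in> J" for i using assms(2)[OF that] openin_imp_subset by blast
  then show "\<Union> (G ` J) = S" using assms(4) by blast
qed (use assms(1,2) in auto)

lemma has_pieces_Un:
  assumes S: "has_pieces S m" and T: "has_pieces T k" and "S \<inter> T = {}"
    and oS: "openin (top_of_set (S \<union> T)) S" and oT: "openin (top_of_set (S \<union> T)) T"
  shows "has_pieces (S \<union> T) (m + k)"
proof -
  obtain \<F> where F: "finite \<F>" "card \<F> = m" "disjoint \<F>" "\<Union>\<F> = S"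
    "\<And>K. K \<in> \<F> \<Longrightarrow> K \<noteq> {} \<and> connected K \<and> openin (top_of_set S) K"
    using S unfolding has_pieces_def by blast
  obtain \<G> where G: "finite \<G>" "card \<G> = k" "disjoint \<G>" "\<Union>\<G> = T"
    "\<And>K. K \<in> \<G> \<Longrightarrow> K \<noteq> {} \<and> connected K \<and> openin (top_of_set T) K"
    using T unfolding has_pieces_def by blast
  have disj: "K \<inter> L = {}" if "K \<in> \<F>" "L \<in> \<G>" for K L using that F(4) G(4) assms(3) by blast
  then have "\<F> \<inter> \<G> = {}" using F(5) by fastforce
  then have "card (\<F> \<union> \<G>) = m + k" using F G by (simp add: card_Un_disjoint)
  moreover have "disjoint (\<F> \<union> \<G>)"
    using disj F(3) G(3) unfolding disjoint_def by (metis Un_iff inf.commute)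
  moreover have "openin (top_of_set (S \<union> T)) K" if "K \<in> \<F> \<union> \<G>" for K
    using that F(5) G(5) oS oT openin_trans by blast
  ultimately show ?thesis unfolding has_pieces_def using F G
    by (intro exI[of _ "\<F> \<union> \<G>"]) auto
qed

text \<open>The complement of a piece is the union of the other pieces, so every piece is clopen;
  being connected and nonempty, it is a component.\<close>

lemma connected_components_of_pieces:
  assumes "has_pieces S m"
  shows "card (connected_components_of (top_of_set S)) = m"
proof -
  let ?X = "top_of_set S"
  obtain \<F> where F: "finite \<F>" "card \<F> = m" "disjoint \<F>" "\<Union>\<F> = S"
    "\<And>K. K \<in> \<F> \<Longrightarrow> K \<noteq> {} \<and> connected K \<and> openin (top_of_set S) K"
    using assms unfolding has_pieces_def by blast
  have sub: "K \<subseteq> S" if "K \<in> \<F>" for K using that F(4) by blast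
  have closed: "closedin ?X K" if "K \<in> \<F>" for K
  proof -
    have "S - K = \<Union> (\<F> - {K})" using F(3,4) that unfolding disjoint_def by blast
    moreover have "openin ?X (\<Union> (\<F> - {K}))" using F(5) by blast
    ultimately show ?thesis using sub[OF that] by (simp add: closedin_def)
  qed
  have eq: "C = K" if C: "C \<in> connected_components_of ?X" and K: "K \<in> \<F>" "C \<inter> K \<noteq> {}" for C K
  proof
    show "C \<subseteq> K"
      using connectedin_clopen_cases[of ?X C K] connectedin_connected_components_of[OF C] closed[OF K(1)] F(5)[OF K(1)] K(2)
      by (auto simp: disjnt_def)
    show "K \<subseteq> C"
      using connected_components_of_maximal[OF C, of K] F(5)[OF K(1)] sub[OF K(1)] K(2)
      by (auto simp: disjnt_def connectedin_subtopology)
  qed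
  have "connected_components_of ?X = \<F>"
  proof (intro equalityI subsetI)
    fix C assume C: "C \<in> connected_components_of ?X"
    then obtain x where "x \<in> C" using nonempty_connected_components_of by blast
    moreover have "C \<subseteq> S" using connected_components_of_subset[OF C] by simp
    ultimately obtain K where "K \<in> \<F>" "x \<in> K" using F(4) by blast
    then show "C \<in> \<F>" using eq[OF C, of K] \<open>x \<in> C\<close> by blast
  next
    fix K assume K: "K \<in> \<F>"
    then obtain x where x: "x \<in> K" using F(5) by blast
    then have "x \<in> \<Union> (connected_components_of ?X)"
      using sub[OF K] by (auto simp: Union_connected_components_of)
    then obtain C where "C \<in> connected_components_of ?X" "x \<in> C" by blast
    then show "K \<in> connected_components_of ?X" using eq[of C K] K x by blast
  qed
  then show ?thesis using F(2) by simp
qed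

section \<open>Continuous sections and slabs between graphs\<close>

lemma continuous_on_Max:
  fixes f :: "'i \<Rightarrow> 'a::topological_space \<Rightarrow> real"
  assumes "finite I" "I \<noteq> {}" "\<And>i. i \<in> I \<Longrightarrow> continuous_on S (f i)"
  shows "continuous_on S (\<lambda>z. Max ((\<lambda>i. f i z) ` I))"
  using assms
proof (induction I rule: finite_ne_induct)
  case (insert i I)
  then show ?case by (auto intro!: continuous_on_max)
qed simp

lemma continuous_on_Min:
  fixes f :: "'i \<Rightarrow> 'a::topological_space \<Rightarrow> real"
  assumes "finite I" "I \<noteq> {}" "\<And>i. i \<in> I \<Longrightarrow> continuous_on S (f i)"
  shows "continuous_on S (\<lambda>z. Min ((\<lambda>i. f i z) ` I))"
  using assms
proof (induction I rule: finite_ne_induct)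
  case (insert i I)
  then show ?case by (auto intro!: continuous_on_min)
qed simp

text \<open>The midpoint of the largest lower and the smallest upper function separates; if one side
  is empty, the extremum of the other is moved by 1.\<close>

lemma continuous_separator:
  fixes f :: "'i \<Rightarrow> 'a::topological_space \<Rightarrow> real"
  assumes "finite L" "finite U" "\<And>i. i \<in> L \<union> U \<Longrightarrow> continuous_on S (f i)"
    and lt: "\<And>z i j. z \<in> S \<Longrightarrow> i \<in> L \<Longrightarrow> j \<in> U \<Longrightarrow> f i z < f j z"
  obtains s where "continuous_on S s"
    "\<And>z i. z \<in> S \<Longrightarrow> i \<in> L \<Longrightarrow> f i z < s z" "\<And>z i. z \<in> S \<Longrightarrow> i \<in> U \<Longrightarrow> s z < f i z"
proof -
  define M where "M z = Max ((\<lambda>i. f i z) ` L)" for z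
  define m where "m z = Min ((\<lambda>i. f i z) ` U)" for z
  have cM: "continuous_on S M" if "L \<noteq> {}"
    unfolding M_def by (rule continuous_on_Max) (use assms that in auto)
  have cm: "continuous_on S m" if "U \<noteq> {}"
    unfolding m_def by (rule continuous_on_Min) (use assms that in auto)
  have M: "f i z \<le> M z" if "i \<in> L" for i z unfolding M_def using assms(1) that by auto
  have m: "m z \<le> f i z" if "i \<in> U" for i z unfolding m_def using assms(2) that by auto
  consider "L = {}" "U = {}" | "L = {}" "U \<noteq> {}" | "L \<noteq> {}" "U = {}" | "L \<noteq> {}" "U \<noteq> {}" by blast
  then show thesis
  proof cases
    case 1
    then show thesis using that[of "\<lambda>_. 0"] by simp
  next
    case 2
    show thesis
    proof (rule that[of "\<lambda>z. m z - 1"])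
      show "continuous_on S (\<lambda>z. m z - 1)" using cm[OF 2(2)] by (intro continuous_intros)
      show "m z - 1 < f i z" if "i \<in> U" for z i using m[OF that, of z] by linarith
    qed (use 2 in simp)
  next
    case 3
    show thesis
    proof (rule that[of "\<lambda>z. M z + 1"])
      show "continuous_on S (\<lambda>z. M z + 1)" using cM[OF 3(1)] by (intro continuous_intros)
      show "f i z < M z + 1" if "i \<in> L" for z i using M[OF that, of z] by linarith
    qed (use 3 in simp)
  next
    case 4
    have gap: "M z < m z" if "z \<in> S" for z
      unfolding M_def m_def using 4 assms(1,2) lt[OF that] by simp
    have "continuous_on S (\<lambda>z. (M z + m z) / 2)"
      using cM cm 4 by (intro continuous_intros) auto
    moreover have "f i z < (M z + m z) / 2" if "z \<in> S" "i \<in> L" for z i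
      using M[OF that(2), of z] gap[OF that(1)] by (simp add: field_simps)
    moreover have "(M z + m z) / 2 < f i z" if "z \<in> S" "i \<in> U" for z i
      using m[OF that(2), of z] gap[OF that(1)] by (simp add: field_simps)
    ultimately show thesis by (intro that[of "\<lambda>z. (M z + m z) / 2"])
  qed
qed

lemma continuous_on_fun_upd:
  fixes g :: "'a::topological_space \<Rightarrow> 'i \<Rightarrow> 'b::topological_space"
  assumes "continuous_on S g" "continuous_on S s"
  shows "continuous_on S (\<lambda>x. (g x)(\<kappa> := s x))"
proof (rule continuous_on_coordinatewise_then_product)
  fix i show "continuous_on S (\<lambda>x. ((g x)(\<kappa> := s x)) i)"
    using assms(2) continuous_on_product_then_coordinatewise[OF assms(1), of i] by (cases "i = \<kappa>") auto
qed

text \<open>Every fibre is an interval and meets the graph of a continuous section \<open>s\<close>, which is connected.\<close>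

lemma connected_between_graphs:
  fixes f :: "'i \<Rightarrow> (nat \<Rightarrow> real) \<Rightarrow> real" and \<kappa> :: nat
  assumes K: "connected K" "K \<noteq> {}"
    and fin: "finite L" "finite U" and cont: "\<And>i. i \<in> L \<union> U \<Longrightarrow> continuous_on K (f i)"
    and lt: "\<And>z i j. z \<in> K \<Longrightarrow> i \<in> L \<Longrightarrow> j \<in> U \<Longrightarrow> f i z < f j z"
  defines "E \<equiv> {z(\<kappa> := t) | z t. z \<in> K \<and> (\<forall>i\<in>L. f i z < t) \<and> (\<forall>i\<in>U. t < f i z)}"
  shows "connected E \<and> E \<noteq> {}"
proof -
  obtain s where s: "continuous_on K s" "\<And>z i. z \<in> K \<Longrightarrow> i \<in> L \<Longrightarrow> f i z < s z"
    "\<And>z i. z \<in> K \<Longrightarrow> i \<in> U \<Longrightarrow> s z < f i z"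
    using continuous_separator[of L U K f, OF fin cont lt] by blast
  define G where "G = (\<lambda>z. z(\<kappa> := s z)) ` K"
  have "connected G" unfolding G_def
    by (intro connected_continuous_image continuous_on_fun_upd s K) (simp add: continuous_on_id)
  define R where "R z = {t. (\<forall>i\<in>L. f i z < t) \<and> (\<forall>i\<in>U. t < f i z)}" for z
  define Fb where "Fb z = (\<lambda>t. z(\<kappa> := t)) ` R z" for z
  have "connected (Fb z)" for z
  proof -
    have "is_interval (R z)" unfolding is_interval_1 R_def by fastforce
    then show ?thesis unfolding Fb_def
      by (intro connected_continuous_image continuous_on_fun_upd continuous_on_const continuous_on_id)
        (simp add: is_interval_connected_1)
  qed
  then have "connected (Fb z \<union> G)" if "z \<in> K" for z
  proof (intro connected_Un \<open>connected G\<close>)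
    have "z(\<kappa> := s z) \<in> Fb z \<inter> G" using s that by (auto simp: Fb_def R_def G_def)
    then show "Fb z \<inter> G \<noteq> {}" by blast
  qed
  moreover have E: "E = (\<Union>z\<in>K. Fb z \<union> G)"
    unfolding E_def Fb_def R_def G_def using s by blast
  moreover have "G \<noteq> {}" using K by (simp add: G_def)
  then have "(\<Inter>z\<in>K. Fb z \<union> G) \<noteq> {}" by blast
  ultimately have "connected E"
    using connected_Union[of "(\<lambda>z. Fb z \<union> G) ` K"] by blast
  then show ?thesis using E K \<open>G \<noteq> {}\<close> by blast
qed

text \<open>Intermediate value theorem: \<open>g - f\<close> is continuous without zeros on a
  connected set.\<close>

lemma constant_order:
  fixes f g :: "'a::topological_space \<Rightarrow> real"
  assumes "connected K" "continuous_on K f" "continuous_on K g" "\<And>z. z \<in> K \<Longrightarrow> f z \<noteq> g z"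
    and "b \<in> K" "f b < g b" "z \<in> K"
  shows "f z < g z"
proof (rule ccontr)
  assume "\<not> f z < g z"
  have "connected ((\<lambda>z. g z - f z) ` K)"
    using assms by (intro connected_continuous_image continuous_intros)
  then have "0 \<in> (\<lambda>z. g z - f z) ` K"
    by (rule connectedD_interval[of _ "g z - f z" "g b - f b"]) (use assms \<open>\<not> f z < g z\<close> in auto)
  then obtain w where "w \<in> K" "f w = g w" by auto
  then show False using assms(4) by blast
qed

text \<open>Over each piece \<open>K\<close> the graphs have a constant order, because they are
  disjoint and \<open>K\<close> is connected. They cut the cylinder over \<open>K\<close> into
  \<open>card I + 1\<close> slabs, each of them connected and relatively open.\<close>

lemma has_pieces_complement_graphs:
  fixes f :: "'i \<Rightarrow> (nat \<Rightarrow> real) \<Rightarrow> real"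
  assumes S: "has_pieces S m" and I: "finite I" and cont: "\<And>i. i \<in> I \<Longrightarrow> continuous_on S (f i)"
    and inj: "\<And>z. z \<in> S \<Longrightarrow> inj_on (\<lambda>i. f i z) I" and \<kappa>: "\<And>z. z \<in> S \<Longrightarrow> z \<kappa> = 0"
  shows "has_pieces {z(\<kappa> := t) | z t. z \<in> S \<and> t \<notin> (\<lambda>i. f i z) ` I} (m * (card I + 1))"
proof -
  define T where "T = {z(\<kappa> := t) | z t. z \<in> S \<and> t \<notin> (\<lambda>i. f i z) ` I}"
  obtain \<F> where F: "finite \<F>" "card \<F> = m" "disjoint \<F>" "\<Union>\<F> = S"
    "\<And>K. K \<in> \<F> \<Longrightarrow> K \<noteq> {} \<and> connected K \<and> openin (top_of_set S) K"
    using S unfolding has_pieces_def by blast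
  obtain b where b: "\<And>K. K \<in> \<F> \<Longrightarrow> b K \<in> K" using F(5) by (metis ex_in_conv)
  \<comment> \<open>The label \<open>None\<close> denotes the slab below all graphs and
    \<open>Some j\<close> the one directly above the graph of \<open>j\<close>; \<open>L\<close>
    collects the graphs below the slab and \<open>U\<close> those above. Their order is read off at
    the base point \<open>b K\<close>.\<close>
  define L where "L K p = (case p of None \<Rightarrow> {} | Some j \<Rightarrow> {i \<in> I. f i (b K) \<le> f j (b K)})" for K p
  define U where "U K p = I - L K p" for K p
  define E where "E K p = {z(\<kappa> := t) | z t. z \<in> K \<and> (\<forall>i\<in>L K p. f i z < t) \<and> (\<forall>i\<in>U K p. t < f i z)}" for K p
  define P where "P = insert None (Some ` I)"
  have sub: "K \<subseteq> S" if "K \<in> \<F>" for K using that F(4) by blast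
  have LU: "L K p \<union> U K p = I" "L K p \<subseteq> I" for K p by (auto simp: U_def L_def split: option.splits)
  have contK: "continuous_on K (f i)" if "K \<in> \<F>" "i \<in> I" for K i
    using cont[OF that(2)] sub[OF that(1)] continuous_on_subset by blast
  have order: "f i z < f j z" if "K \<in> \<F>" "i \<in> I" "j \<in> I" "f i (b K) < f j (b K)" "z \<in> K" for K i j z
  proof (rule constant_order[of K "f i" "f j" "b K"])
    have "i \<noteq> j" using that by auto
    then show "f i w \<noteq> f j w" if "w \<in> K" for w
      using inj[of w] sub \<open>K \<in> \<F>\<close> that \<open>i \<in> I\<close> \<open>j \<in> I\<close> by (auto simp: inj_on_def)
  qed (use that F(5) contK b in auto)
  \<comment> \<open>Since the coordinate \<open>\<kappa>\<close> vanishes on \<open>S\<close>,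
    setting it to 0 recovers the base point of a fibre.\<close>
  have upd0: "(z(\<kappa> := t))(\<kappa> := 0) = z" if "z \<in> S" for z t using \<kappa>[OF that] by (auto simp: fun_eq_iff)
  have conn: "connected (E K p) \<and> E K p \<noteq> {}" if K: "K \<in> \<F>" for K p
    unfolding E_def
  proof (rule connected_between_graphs)
    show "f i z < f j z" if "z \<in> K" "i \<in> L K p" "j \<in> U K p" for z i j
    proof (rule order[OF K _ _ _ that(1)])
      show "i \<in> I" "j \<in> I" using that by (auto simp: U_def L_def split: option.splits)
      show "f i (b K) < f j (b K)" using that by (auto simp: U_def L_def split: option.splits)
    qed
    show "finite (L K p)" "finite (U K p)" using finite_subset[OF LU(2) I] I by (auto simp: U_def)
    show "continuous_on K (f i)" if "i \<in> L K p \<union> U K p" for i using that LU(1) contK[OF K] by blast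
  qed (use K F(5) in auto)
  have "has_pieces T (card (\<F> \<times> P))"
  proof (rule has_piecesI[where G = "\<lambda>(K, p). E K p"])
    show "finite (\<F> \<times> P)" using F(1) I by (simp add: P_def)
    fix x assume "x \<in> \<F> \<times> P"
    then obtain K p where x: "x = (K, p)" "K \<in> \<F>" "p \<in> P" by auto
    have ET: "E K p \<subseteq> T"
    proof
      fix w assume "w \<in> E K p"
      then obtain z t where w: "w = z(\<kappa> := t)" "z \<in> K" "\<forall>i\<in>L K p. f i z < t" "\<forall>i\<in>U K p. t < f i z"
        unfolding E_def by blast
      then have "t \<noteq> f i z" if "i \<in> I" for i using that LU(1)[of K p] by fastforce
      then show "w \<in> T" using w sub[OF x(2)] unfolding T_def by blast
    qed
    let ?\<pi> = "\<lambda>w. w(\<kappa> := 0 :: real)"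
    have \<pi>T: "?\<pi> w \<in> S" if "w \<in> T" for w using that upd0 by (auto simp: T_def)
    have c\<pi>: "continuous_on T ?\<pi>" by (intro continuous_on_fun_upd continuous_on_id continuous_on_const)
    have cf: "continuous_on T (\<lambda>w. f i (?\<pi> w) - w \<kappa>)" if "i \<in> I" for i
    proof (rule continuous_on_diff)
      show "continuous_on T (\<lambda>w. f i (?\<pi> w))"
        by (rule continuous_on_compose2[OF cont[OF that] c\<pi>]) (use \<pi>T in auto)
      show "continuous_on T (\<lambda>w. w \<kappa>)"
        by (rule continuous_on_subset[OF continuous_on_product_coordinates]) simp
    qed
    have oK: "openin (top_of_set T) (T \<inter> ?\<pi> -` K)"
    proof (rule continuous_openin_preimage[OF c\<pi>])
      show "?\<pi> \<in> T \<rightarrow> S" using \<pi>T by blast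
      show "openin (top_of_set S) K" using F(5) x(2) by blast
    qed
    \<comment> \<open>A slab is cut out of \<open>T\<close> by the preimage of \<open>K\<close> and
      finitely many strict inequalities; \<open>W\<close> expresses these as an intersection of open
      preimages.\<close>
    define W where "W M A = (\<Inter>i\<in>M. T \<inter> (\<lambda>w. f i (?\<pi> w) - w \<kappa>) -` A) \<inter> T" for M A
    have W_iff: "w \<in> W M A \<longleftrightarrow> w \<in> T \<and> (\<forall>i\<in>M. f i (?\<pi> w) - w \<kappa> \<in> A)" for w M A
      unfolding W_def by blast
    have oW: "openin (top_of_set T) (W M A)" if "M \<subseteq> I" "open A" for M A
    proof -
      have "finite M" using that(1) I by (rule finite_subset)
      then have "openin (top_of_set T)
          ((\<Inter>i\<in>M. T \<inter> (\<lambda>w. f i (?\<pi> w) - w \<kappa>) -` A) \<inter> topspace (top_of_set T))"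
      proof (rule openin_INT)
        fix i assume "i \<in> M"
        then have "i \<in> I" using that(1) by blast
        then show "openin (top_of_set T) (T \<inter> (\<lambda>w. f i (?\<pi> w) - w \<kappa>) -` A)"
          by (rule continuous_openin_preimage_gen[OF cf that(2)])
      qed
      then show ?thesis by (simp add: W_def)
    qed
    have "U K p \<subseteq> I" by (auto simp: U_def)
    then have "openin (top_of_set T) ((T \<inter> ?\<pi> -` K) \<inter> (W (L K p) {..<0} \<inter> W (U K p) {0<..}))"
      by (intro openin_Int[OF oK] openin_Int[OF oW oW] LU(2)) auto
    also have "(T \<inter> ?\<pi> -` K) \<inter> (W (L K p) {..<0} \<inter> W (U K p) {0<..}) = E K p"
    proof (intro equalityI subsetI)
      fix w assume "w \<in> E K p"
      then obtain z t where w: "w = z(\<kappa> := t)" "z \<in> K" "\<forall>i\<in>L K p. f i z < t" "\<forall>i\<in>U K p. t < f i z"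
        unfolding E_def by blast
      then have "?\<pi> w = z" "w \<kappa> = t" using upd0 sub[OF x(2)] by auto
      then show "w \<in> (T \<inter> ?\<pi> -` K) \<inter> (W (L K p) {..<0} \<inter> W (U K p) {0<..})"
        using w(2-) \<open>w \<in> E K p\<close> ET unfolding Int_iff W_iff by auto
    next
      fix w assume w: "w \<in> (T \<inter> ?\<pi> -` K) \<inter> (W (L K p) {..<0} \<inter> W (U K p) {0<..})"
      have "w = (?\<pi> w)(\<kappa> := w \<kappa>)" by simp
      moreover have "?\<pi> w \<in> K" "\<forall>i\<in>L K p. f i (?\<pi> w) < w \<kappa>" "\<forall>i\<in>U K p. w \<kappa> < f i (?\<pi> w)"
        using w unfolding Int_iff W_iff by auto
      ultimately show "w \<in> E K p" unfolding E_def by blast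
    qed
    finally show "(case x of (K, p) \<Rightarrow> E K p) \<noteq> {} \<and> connected (case x of (K, p) \<Rightarrow> E K p) \<and>
        openin (top_of_set T) (case x of (K, p) \<Rightarrow> E K p)"
      using conn[OF x(2), of p] x(1) by simp
  next
    fix x y assume "x \<in> \<F> \<times> P" "y \<in> \<F> \<times> P" "x \<noteq> y"
    then obtain K p K' p' where xy: "x = (K, p)" "y = (K', p')" "K \<in> \<F>" "p \<in> P" "K' \<in> \<F>" "p' \<in> P" by auto
    \<comment> \<open>Between different slabs over the same \<open>K\<close> there is a graph that
      lies below one and above the other.\<close>
    have sep: "(\<exists>i. i \<in> L K p \<and> i \<in> U K p') \<or> (\<exists>i. i \<in> U K p \<and> i \<in> L K p')" if "p \<noteq> p'"
    proof -
      have "f i (b K) \<noteq> f j (b K)" if "i \<in> I" "j \<in> I" "i \<noteq> j" for i j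
        using that inj[of "b K"] b[OF xy(3)] sub[OF xy(3)] by (auto simp: inj_on_def)
      then show ?thesis using xy(4,6) that unfolding P_def U_def L_def
        by (auto split: option.splits) (metis less_eq_real_def linorder_not_le order.trans)+
    qed
    show "(case x of (K, p) \<Rightarrow> E K p) \<inter> (case y of (K, p) \<Rightarrow> E K p) = {}"
    proof (rule ccontr)
      assume "(case x of (K, p) \<Rightarrow> E K p) \<inter> (case y of (K, p) \<Rightarrow> E K p) \<noteq> {}"
      then obtain w where "w \<in> E K p" "w \<in> E K' p'" using xy by auto
      then obtain z t z' t' where w: "w = z(\<kappa> := t)" "z \<in> K" "\<forall>i\<in>L K p. f i z < t" "\<forall>i\<in>U K p. t < f i z"
        "w = z'(\<kappa> := t')" "z' \<in> K'" "\<forall>i\<in>L K' p'. f i z' < t'" "\<forall>i\<in>U K' p'. t' < f i z'"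
        unfolding E_def by blast
      have z: "z = z'" using w(1,5) upd0 sub[OF xy(3)] sub[OF xy(5)] w(2,6) by (metis subsetD)
      have t: "t = t'" using w(1,5) by (metis fun_upd_same)
      have "K = K'" using F(3) xy(3,5) w(2,6) z unfolding disjoint_def by blast
      then have "p \<noteq> p'" using \<open>x \<noteq> y\<close> xy by simp
      then show False using sep w(3,4,7,8) z t \<open>K = K'\<close> by (meson order.asym)
    qed
  next
    show "T \<subseteq> \<Union> ((\<lambda>(K, p). E K p) ` (\<F> \<times> P))"
    proof
      fix w assume "w \<in> T"
      then obtain z t where w: "w = z(\<kappa> := t)" "z \<in> S" "t \<notin> (\<lambda>i. f i z) ` I" unfolding T_def by blast
      then obtain K where K: "K \<in> \<F>" "z \<in> K" using F(4) by blast
      have ne: "f i z \<noteq> t" if "i \<in> I" for i using w(3) that by auto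
      let ?B = "{i \<in> I. f i z < t}"
      \<comment> \<open>The label comes from the highest graph below \<open>t\<close>, or is
        \<open>None\<close> if no graph lies below.\<close>
      have "\<exists>p\<in>P. (\<forall>i\<in>L K p. f i z < t) \<and> (\<forall>i\<in>U K p. t < f i z)"
      proof (cases "?B = {}")
        case True
        have "(\<forall>i\<in>L K None. f i z < t) \<and> (\<forall>i\<in>U K None. t < f i z)"
        proof -
          have "t < f i z" if "i \<in> I" for i using True ne[OF that] that by force
          then show ?thesis by (simp add: L_def U_def)
        qed
        then show ?thesis by (auto simp: P_def)
      next
        case False
        have "finite ((\<lambda>i. f i z) ` ?B)" using I by simp
        then have "Max ((\<lambda>i. f i z) ` ?B) \<in> (\<lambda>i. f i z) ` ?B" using False by (intro Max_in) auto
        then obtain j where j: "j \<in> I" "f j z < t" "f j z = Max ((\<lambda>i. f i z) ` ?B)" by auto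
        have max: "f i z \<le> f j z" if "i \<in> I" "f i z < t" for i
          unfolding j(3) using that I by (intro Max_ge) auto
        have "f i z < t" if "i \<in> L K (Some j)" for i
        proof (cases "i = j")
          case False
          have i: "i \<in> I" "f i (b K) \<le> f j (b K)" using that by (auto simp: L_def)
          then have "f i (b K) < f j (b K)"
            using inj[of "b K"] b[OF K(1)] sub[OF K(1)] False j(1) by (force simp: inj_on_def)
          then show ?thesis using order[OF K(1) i(1) j(1) _ K(2)] j(2) by fastforce
        qed (use j in simp)
        moreover have "t < f i z" if "i \<in> U K (Some j)" for i
        proof -
          have i: "i \<in> I" "f j (b K) < f i (b K)" using that by (auto simp: L_def U_def)
          then have "f j z < f i z" using order[OF K(1) j(1) i(1) _ K(2)] by blast
          then show ?thesis using max[OF i(1)] ne[OF i(1)] by linarith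
        qed
        ultimately show ?thesis using j(1) by (intro bexI[of _ "Some j"]) (auto simp: P_def)
      qed
      then show "w \<in> \<Union> ((\<lambda>(K, p). E K p) ` (\<F> \<times> P))"
        using K w(1) unfolding E_def by fastforce
    qed
  qed
  moreover have "card P = card I + 1" using I by (simp add: P_def card_image)
  ultimately show ?thesis unfolding T_def using F(2) by (simp add: card_cartesian_product)
qed

section \<open>Real points\<close>

lemma continuous_on_coordinate: "continuous_on S (\<lambda>z. z i)"
  for S :: "('i \<Rightarrow> 'b::topological_space) set"
  by (rule continuous_on_subset[OF continuous_on_product_coordinates]) simp

lemma continuous_on_removed_pt:
  fixes S :: "(nat \<Rightarrow> real) set"
  assumes "S \<subseteq> sym_configs k" "j \<in> removed_idx k sq"
  shows "continuous_on S (\<lambda>z. removed_pt (sqrt (z 1)) z j)"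
proof -
  note [continuous_intros] = continuous_on_coordinate
  from assms(2) show ?thesis
  proof (cases rule: removed_idx_cases)
    case (5 i)
    then have "z i \<noteq> 0" if "z \<in> S" for z using that assms(1) by (auto simp: sym_configs_def)
    then have "continuous_on S (\<lambda>z. z 1 / z i)" by (intro continuous_intros) auto
    then show ?thesis using 5 by (simp add: removed_pt_def)
  next
    case (4 i)
    then show ?thesis using continuous_on_coordinate[of S i] by (simp add: removed_pt_def)
  next
    case 2
    have "continuous_on S (\<lambda>z. sqrt (z 1))" by (intro continuous_intros)
    then show ?thesis using 2 by (simp add: removed_pt_def)
  next
    case 3
    have "continuous_on S (\<lambda>z. - sqrt (z 1))" by (intro continuous_intros)
    then show ?thesis using 3 by (simp add: removed_pt_def)
  qed (simp add: removed_pt_def)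
qed

lemma has_pieces_connected: "connected S \<Longrightarrow> S \<noteq> {} \<Longrightarrow> has_pieces S 1"
  unfolding has_pieces_def by (intro exI[of _ "{S}"]) (auto simp: disjoint_def)

text \<open>On positive parameters \<open>sqrt\<close> is a continuous choice of the root, so the
  forbidden values form disjoint graphs over \<open>configs_over m A\<close>, and
  \<open>has_pieces_complement_graphs\<close> applies at each step.\<close>

lemma has_pieces_configs_over:
  fixes A :: "real set"
  assumes "k \<ge> 2" "connected A" "A \<noteq> {}" "0 \<notin> A" "1 \<notin> A"
    and sq: "\<And>a. a \<in> A \<Longrightarrow> sq \<longleftrightarrow> a > 0"
  shows "has_pieces (configs_over k A) (\<Prod>m=2..<k. card (removed_idx m sq) + 1)"
  using assms(1)
proof (induction k rule: dec_induct)
  case base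
  have A: "A - {0, 1} = A" using assms(4,5) by auto
  have "continuous_on A (\<lambda>a j :: nat. if j = 1 then a else if j = 2 then 1 else 0)"
  proof (rule continuous_on_coordinatewise_then_product)
    fix i show "continuous_on A (\<lambda>a. if i = 1 then a else if i = 2 then 1 else 0)"
      by (cases "i = 1"; cases "i = 2") (auto intro: continuous_intros)
  qed
  then have "connected (configs_over 2 A)"
    unfolding configs_over_2 A by (rule connected_continuous_image[OF _ assms(2)])
  moreover have "configs_over 2 A \<noteq> {}" unfolding configs_over_2 A using assms(3) by blast
  ultimately show ?case using has_pieces_connected[of "configs_over 2 A"] by simp
next
  case (step m)
  let ?S = "configs_over m A"
  have "has_pieces {z(Suc m := t) | z t. z \<in> ?S \<and>
      t \<notin> (\<lambda>j. removed_pt (sqrt (z 1)) z j) ` removed_idx m sq}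
    ((\<Prod>m=2..<m. card (removed_idx m sq) + 1) * (card (removed_idx m sq) + 1))"
  proof (rule has_pieces_complement_graphs[OF step.IH])
    show "finite (removed_idx m sq)" by (simp add: removed_idx_def)
    show "continuous_on ?S (\<lambda>z. removed_pt (sqrt (z 1)) z j)" if "j \<in> removed_idx m sq" for j
      by (rule continuous_on_removed_pt[OF _ that]) (auto simp: configs_over_def)
    show "inj_on (\<lambda>j. removed_pt (sqrt (z 1)) z j) (removed_idx m sq)" if "z \<in> ?S" for z
      using inj_removed_pt[of sq "sqrt (z 1)" z m] that sq[of "z 1"] by (simp add: configs_over_def)
    show "z (Suc m) = 0" if "z \<in> ?S" for z
      using that by (simp add: configs_over_def sym_configs_def)
  qed
  moreover have "configs_over (Suc m) A = {z(Suc m := t) | z t. z \<in> ?S \<and>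
      t \<notin> removed_pt (sqrt (z 1)) z ` removed_idx m sq}"
  proof (rule configs_over_Suc[OF step.hyps(1)])
    show "sqrt a * sqrt a = a" if "a \<in> A" sq for a using sq[OF that(1)] that(2) by simp
    show "\<nexists>s. s * s = a" if "a \<in> A" "\<not> sq" for a
      using sq[OF that(1)] that assms(4) by (metis linorder_neqE_linordered_idom not_square_less_zero)
  qed
  ultimately show ?case using step.hyps by (simp only: prod.atLeastLessThan_Suc)
qed

lemma has_pieces_configs_over_Un:
  fixes A B :: "real set"
  assumes "open A" "open B" "A \<inter> B = {}"
    and "has_pieces (configs_over k A) m" "has_pieces (configs_over k B) l"
  shows "has_pieces (configs_over k (A \<union> B)) (m + l)"
proof -
  have eq: "configs_over k (A \<union> B) = configs_over k A \<union> configs_over k B"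
    by (auto simp: configs_over_def)
  have op: "openin (top_of_set (configs_over k A \<union> configs_over k B)) (configs_over k C)"
    if "open C" "C = A \<or> C = B" for C
  proof -
    have "configs_over k C = configs_over k (A \<union> B) \<inter> (\<lambda>z. z 1) -` C"
      using that(2) by (auto simp: configs_over_def)
    then show ?thesis unfolding eq[symmetric]
      using continuous_openin_preimage_gen[OF continuous_on_coordinate that(1)] by simp
  qed
  show ?thesis unfolding eq
    by (rule has_pieces_Un[OF assms(4,5)]) (use assms(1-3) op in \<open>auto simp: configs_over_def\<close>)
qed

text \<open>The parameter ranges over \<open>a < 0\<close>, \<open>0 < a < 1\<close> and
  \<open>a > 1\<close>. Step \<open>m\<close> multiplies the pieces by \<open>2m\<close> in the
  first range and by \<open>2m + 2\<close> in the other two, whose equal shares add up to the second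
  summand.\<close>

lemma has_pieces_sym_configs:
  assumes n: "n \<ge> 1"
  shows "has_pieces (sym_configs (n + 1) :: (nat \<Rightarrow> real) set) (2 ^ (n - 1) * fact n + 2 ^ (n - 1) * fact (n + 1))"
proof -
  let ?k = "n + 1"
  have k: "?k \<ge> 2" using n by simp
  have p1: "(\<Prod>m=2..<?k. card (removed_idx m False) + 1) = 2 ^ (n - 1) * fact n"
    using n
  proof (induction n rule: dec_induct)
    case (step m)
    then show ?case using card_removed_idx[of "Suc m" False]
      by (cases m) (simp_all add: algebra_simps)
  qed simp
  have p2: "2 * (\<Prod>m=2..<?k. card (removed_idx m True) + 1) = 2 ^ (n - 1) * fact (n + 1)"
    using n
  proof (induction n rule: dec_induct)
    case (step m)
    have "2 * (\<Prod>m=2..<Suc m + 1. card (removed_idx m True) + 1) =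
        (2 * (\<Prod>m=2..<m + 1. card (removed_idx m True) + 1)) * (2 * Suc m + 2)"
      using step.hyps card_removed_idx[of "Suc m" True] by simp
    also have "\<dots> = 2 ^ (m - 1) * fact (m + 1) * (2 * Suc m + 2)" unfolding step.IH ..
    also have "\<dots> = 2 ^ (Suc m - 1) * fact (Suc m + 1)"
      using step.hyps by (cases m) (simp_all add: algebra_simps)
    finally show ?case .
  qed (simp add: numeral_2_eq_2)
  have "has_pieces (configs_over ?k ({..<0 :: real} \<union> ({0<..<1} \<union> {1<..})))
      ((\<Prod>m=2..<?k. card (removed_idx m False) + 1) +
        ((\<Prod>m=2..<?k. card (removed_idx m True) + 1) + (\<Prod>m=2..<?k. card (removed_idx m True) + 1)))"
  proof (intro has_pieces_configs_over_Un)
    show "has_pieces (configs_over ?k {..<0 :: real}) (\<Prod>m=2..<?k. card (removed_idx m False) + 1)"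
      by (rule has_pieces_configs_over[OF k]) auto
    show "has_pieces (configs_over ?k {0<..<1 :: real}) (\<Prod>m=2..<?k. card (removed_idx m True) + 1)"
      by (rule has_pieces_configs_over[OF k]) auto
    show "has_pieces (configs_over ?k {1 :: real<..}) (\<Prod>m=2..<?k. card (removed_idx m True) + 1)"
      by (rule has_pieces_configs_over[OF k]) auto
  qed auto
  moreover have "configs_over ?k ({..<0 :: real} \<union> ({0<..<1} \<union> {1<..})) = (sym_configs ?k :: (nat \<Rightarrow> real) set)"
  proof -
    have "z 1 \<in> {..<0} \<union> ({0<..<1} \<union> {1<..})" if z: "z \<in> sym_configs ?k" for z :: "nat \<Rightarrow> real"
    proof -
      have "2 \<in> {2..?k}" using k by simp
      then have "z 2 * z 2 \<noteq> z 1" using z unfolding sym_configs_def by blast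
      moreover have "z 2 = 1" "z 1 \<noteq> 0" using z unfolding sym_configs_def by blast+
      ultimately show ?thesis by auto
    qed
    then show ?thesis unfolding configs_over_def by blast
  qed
  ultimately show ?thesis unfolding p1 mult_2[symmetric] p2 by simp
qed

section \<open>The homeomorphism with the real configuration space\<close>

lemma continuous_on_pts:
  fixes S :: "(nat \<Rightarrow> real) set"
  shows "continuous_on S (\<lambda>z. pts h z j)"
proof -
  note [continuous_intros] = continuous_on_coordinate
  have "continuous_on S (\<lambda>z. (inv_pt (z 1) ^^ m) (g z))" if "continuous_on S g" for m g
  proof (induction m)
    case (Suc m)
    then show ?case unfolding funpow.simps o_def inv_pt_def[of _ "(_ ^^ m) _"] by (intro continuous_intros)
  qed (use that in simp)
  moreover have "continuous_on S (\<lambda>z. if (j - 1) mod h = 0 then (1, 0) else (z ((j - 1) mod h + 1), 1))"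
    by (cases "(j - 1) mod h = 0") (auto intro!: continuous_intros)
  ultimately show ?thesis unfolding pts_def by blast
qed

lemma continuous_on_cross_ratio_pts:
  assumes "h \<ge> 1" "nonadj (2 * h) i j"
  shows "continuous_on (sym_configs h :: (nat \<Rightarrow> real) set) (\<lambda>z. cross_ratio (pts h z) i j)"
proof -
  have "cross_ratio (pts h z) i j \<noteq> 0" if "z \<in> sym_configs h" for z :: "nat \<Rightarrow> real"
    using u_solution.nonzero[OF u_solution_pts[OF that assms(1)] assms(2)] .
  \<comment> \<open>Division by zero yields 0, so a nonzero cross ratio has a nonzero denominator;
    this includes the case \<open>j + 1 = 2 * h + 1\<close>.\<close>
  then have "br (pts h z i) (pts h z j) * br (pts h z (i + 1)) (pts h z (j + 1)) \<noteq> 0"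
    if "z \<in> sym_configs h" for z :: "nat \<Rightarrow> real"
    using that unfolding cross_ratio_def by (metis div_by_0)
  then show ?thesis
    unfolding cross_ratio_def br_def by (intro continuous_intros continuous_on_pts) blast
qed

lemma continuous_map_u_of_config:
  assumes n: "n \<ge> 1"
  shows "continuous_map (top_of_set (sym_configs (n + 1))) (config_space_real n) (u_of_config n)"
  unfolding config_space_real_def
proof (rule continuous_map_into_subtopology)
  show "u_of_config n \<in> topspace (top_of_set (sym_configs (n + 1))) \<rightarrow> config_space n"
    using u_of_config_in[OF n] by auto
  have "continuous_on (sym_configs (n + 1)) (\<lambda>z :: nat \<Rightarrow> real. u_of_config n z \<gamma>)"
    if g: "\<gamma> \<in> diag_classes n" for \<gamma>
  proof -
    obtain i j where ij: "\<gamma> = cls (n + 1) i j" "nonadj (2 * (n + 1)) i j"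
      using g diag_classes_eq[OF n] by blast
    have eq: "cross_ratio (pts (n + 1) z) i j = u_of_config n z \<gamma>" if "z \<in> sym_configs (n + 1)" for z :: "nat \<Rightarrow> real"
    proof -
      have "z 1 \<noteq> 0" using that unfolding sym_configs_def by blast
      then show ?thesis unfolding ij(1) by (rule u_of_config_cls[OF n _ ij(2), symmetric])
    qed
    show ?thesis
      by (rule continuous_on_eq[OF continuous_on_cross_ratio_pts[OF _ ij(2)] eq]) simp_all
  qed
  moreover have "u_of_config n z \<in> extensional (diag_classes n)" for z :: "nat \<Rightarrow> real"
    unfolding u_of_config_def by (rule restrict_extensional)
  ultimately show "continuous_map (top_of_set (sym_configs (n + 1)))
      (product_topology (\<lambda>_. euclideanreal) (diag_classes n)) (u_of_config n)"
    unfolding continuous_map_componentwise continuous_map_iff_continuous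
    by (intro conjI ballI image_subsetI)
qed

lemma continuous_map_config_of:
  assumes n: "n \<ge> 1"
  shows "continuous_map (config_space_real n) (top_of_set (sym_configs (n + 1))) (config_of n)"
proof (rule continuous_map_into_subtopology)
  let ?X = "config_space_real n" and ?h = "n + 1"
  have top: "topspace ?X = config_space n"
    by (auto simp: config_space_real_def config_space_def PiE_def)
  then show "config_of n \<in> topspace ?X \<rightarrow> sym_configs ?h" using config_of_in[OF n] by auto
  have V: "continuous_map ?X euclideanreal (\<lambda>u. u (cls ?h i j))" if "nonadj (2 * ?h) i j" for i j
    unfolding config_space_real_def
    by (intro continuous_map_from_subtopology continuous_map_product_projection cls_in n that)
  have S: "continuous_map ?X euclideanreal (\<lambda>u. sprod (\<lambda>i j. u (cls ?h i j)) A B)"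
    if "finite A" "finite B" "\<And>i j. i \<in> A \<Longrightarrow> j \<in> B \<Longrightarrow> nonadj (2 * ?h) i j" for A B
    unfolding sprod_def by (intro continuous_map_prod V that)
  have "nonadj (2 * ?h) 1 (?h + 1)" using n by (simp add: nonadj_def)
  \<comment> \<open>The only coordinate with a division; its divisor is a value of \<open>u\<close>,
    hence nonzero.\<close>
  have a: "continuous_map ?X euclideanreal
      (\<lambda>u. - sprod (\<lambda>i j. u (cls ?h i j)) {2..<?h+1} {?h+2..<2*?h+1} / u (cls ?h 1 (?h + 1)))"
  proof (intro continuous_map_real_divide continuous_map_minus S V)
    show "u (cls ?h 1 (?h + 1)) \<noteq> 0" if "u \<in> topspace ?X" for u
      using that cls_in[OF n \<open>nonadj (2 * ?h) 1 (?h + 1)\<close>] unfolding top by (auto simp: config_space_def)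
  qed (use n in \<open>auto simp: nonadj_def\<close>)
  have "continuous_map ?X euclideanreal (\<lambda>u. config_of n u j)" for j
  proof -
    consider "j = 1" | "j \<noteq> 1" "2 \<le> j" "j \<le> ?h" | "j \<noteq> 1" "\<not> (2 \<le> j \<and> j \<le> ?h)" by blast
    then show ?thesis
    proof cases
      case 1
      then show ?thesis using a by (simp add: config_of_u_def)
    next
      case 2
      have "continuous_map ?X euclideanreal (\<lambda>u. sprod (\<lambda>i j. u (cls ?h i j)) {2..<j} {?h+1..<2*?h+1})"
        by (rule S) (use 2 in \<open>auto simp: nonadj_def\<close>)
      then show ?thesis using 2 by (simp add: config_of_u_def)
    next
      case 3
      then have "(\<lambda>u :: nat set set \<Rightarrow> real. config_of n u j) = (\<lambda>_. 0)"
        by (auto simp: config_of_u_def fun_eq_iff)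
      then show ?thesis by simp
    qed
  qed
  then show "continuous_map ?X euclidean (config_of n)"
    unfolding euclidean_product_topology[symmetric] continuous_map_componentwise_UNIV by blast
qed

text \<open>\<open>u_of_config\<close> and \<open>config_of\<close> are inverse continuous maps, and
  a homeomorphism maps components bijectively to components.\<close>

lemma card_components_config_space_real:
  assumes n: "n \<ge> 1"
  shows "card (connected_components_of (config_space_real n)) = 2 ^ (n - 1) * fact n + 2 ^ (n - 1) * fact (n + 1)"
proof -
  let ?X = "top_of_set (sym_configs (n + 1) :: (nat \<Rightarrow> real) set)"
  have top: "topspace (config_space_real n) = config_space n"
    by (auto simp: config_space_real_def config_space_def PiE_def)
  have "homeomorphic_maps ?X (config_space_real n) (u_of_config n) (config_of n)"
    unfolding homeomorphic_maps_def top topspace_euclidean_subtopology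
  proof (intro conjI ballI)
    show "config_of n (u_of_config n z) = z" if "z \<in> sym_configs (n + 1)" for z :: "nat \<Rightarrow> real"
      by (rule config_of_u_of_config[OF n that])
    show "u_of_config n (config_of n u) = u" if "u \<in> config_space n" for u :: "nat set set \<Rightarrow> real"
      by (rule u_of_config_config_of[OF n that])
  qed (use continuous_map_u_of_config[OF n] continuous_map_config_of[OF n] in blast)+
  then have "connected_components_of (config_space_real n) = (image (u_of_config n)) ` connected_components_of ?X"
    by (intro homeomorphic_map_connected_components_of homeomorphic_maps_imp_map)
  moreover have "inj_on (image (u_of_config n)) (connected_components_of ?X)"
  proof (rule inj_on_subset[OF inj_on_image_Pow])
    show "inj_on (u_of_config n) (sym_configs (n + 1) :: (nat \<Rightarrow> real) set)"
      using bij_betw_u_of_config[OF n] by (rule bij_betw_imp_inj_on)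
    show "connected_components_of ?X \<subseteq> Pow (sym_configs (n + 1))"
      using connected_components_of_subset[of _ ?X] by (auto simp del: Pow_iff intro!: PowI)
  qed
  ultimately have "card (connected_components_of (config_space_real n)) = card (connected_components_of ?X)"
    by (simp add: card_image)
  then show ?thesis using connected_components_of_pieces[OF has_pieces_sym_configs[OF n]] by simp
qed

theorem proposition7p6:
  fixes n :: nat
  assumes "n \<ge> 1"
  shows "(CHAR('a::{field,finite}) > 2 \<longrightarrow>
           int (card (config_space n :: (nat set set \<Rightarrow> 'a) set)) =
             (int CARD('a) - int n - 1) * (\<Prod>k=2..n. int CARD('a) - (2 * int k - 1))) \<and>
         real (card (connected_components_of (config_space_real n))) =
           1 / 2 * (2 ^ n * fact (n + 1) + 2 ^ n * fact n) \<and>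
         1 / 2 * (2 ^ n * fact (n + 1) + 2 ^ n * fact n) = (2 ^ (n - 1) * (real n + 2) * fact n :: real)"
proof (intro conjI impI)
  assume char: "CHAR('a) > 2"
  have "\<not> CHAR('a) dvd 2" using char by (auto dest: dvd_imp_le)
  then have "(2 :: 'a) \<noteq> 0" using of_nat_eq_0_iff_char_dvd[of 2, where 'a = 'a] by simp
  then show "int (card (config_space n :: (nat set set \<Rightarrow> 'a) set)) =
      (int CARD('a) - int n - 1) * (\<Prod>k=2..n. int CARD('a) - (2 * int k - 1))"
    using card_sym_configs[OF _ assms, where 'a = 'a] bij_betw_same_card[OF bij_betw_u_of_config[OF assms, where 'a = 'a]] by simp
next
  have pow: "(2 :: real) ^ n = 2 * 2 ^ (n - 1)" using assms by (cases n) auto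
  show "real (card (connected_components_of (config_space_real n))) =
      1 / 2 * (2 ^ n * fact (n + 1) + 2 ^ n * fact n)"
    unfolding card_components_config_space_real[OF assms] pow by (simp add: algebra_simps)
  show "1 / 2 * (2 ^ n * fact (n + 1) + 2 ^ n * fact n) = (2 ^ (n - 1) * (real n + 2) * fact n :: real)"
    unfolding pow by (simp add: algebra_simps)
qed

end
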